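(* Let $X_1,\ldots,X_n,Y_1,\ldots,Y_n$ be non-negative random variables with distributions $F_1,\ldots,F_n,G_1,\ldots,G_n$ respectively, all from the class $\mathcal{D}\cap\mathcal{L}$, which are generalized tail asymptotically independent (GTAI), with $(X_k,Y_l)\in(\mathcal{D}\cap\mathcal{L})^{(2)}$ for all $k,l\in\{1,\ldots,n\}$. Let $\Theta_1,\ldots,\Theta_n,\Delta_1,\ldots,\Delta_n$ be random variables, independent of $X_1,\ldots,X_n,Y_1,\ldots,Y_n$, such that there exist constants $0<\xi_k\le\delta_k$ and $0<\gamma_l\le\zeta_l$ with $\xi_k\le\Theta_k\le\delta_k$ almost surely for every $k=1,\ldots,n$ and $\gamma_l\le\Delta_l\le\zeta_l$ almost surely for every $l=1,\ldots,n$. Then the products $\Theta_1X_1,\ldots,\Theta_nX_n,\Delta_1Y_1,\ldots,\Delta_nY_n$ are GTAI, and $(\Theta_kX_k,\Delta_lY_l)\in(\mathcal{D}\cap\mathcal{L})^{(2)}$ for all $k,l\in\{1,\ldots,n\}$. If, further, $X_1,\ldots,X_n$ are tail asymptotically independent (TAI) and $Y_1,\ldots,Y_n$ are TAI, then, with $S_i^{\Theta}=\sum_{k=1}^i\Theta_kX_k$ and $T_j^{\Delta}=\sum_{l=1}^j\Delta_lY_l$, as $x\wedge y\to\infty$, $$\mathbf{P}[S_n^{\Theta}>x,\ T_n^{\Delta}>y]\sim\mathbf{P}\Big[\max_{1\le i\le n}S_i^{\Theta}>x,\ \max_{1\le j\le n}T_j^{\Delta}>y\Big]\sim\mathbf{P}\Big[\max_{1\le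 k\le n}\Theta_kX_k>x,\ \max_{1\le l\le n}\Delta_lY_l>y\Big]\sim\sum_{k=1}^n\sum_{l=1}^n\mathbf{P}[\Theta_kX_k>x,\ \Delta_lY_l>y].$$
   Context: Notation: $x\wedge y=\min\{x,y\}$; $f(x,y)\sim g(x,y)$ as $x\wedge y\to\infty$ means $\lim_{x\wedge y\to\infty} f(x,y)/g(x,y)=1$. For a distribution $F$, $\overline F=1-F$; the distributions $F_k,G_l$ have tails positive on $[0,\infty)$. Joint tails appearing in denominators or as conditioning events are implicitly assumed positive. No assumption is made on the dependence among $\Theta_1,\ldots,\Theta_n,\Delta_1,\ldots,\Delta_n$. One-dimensional classes: $F\in\mathcal{L}$ (long-tailed) if $\lim_{x\to\infty}\overline F(x-a)/\overline F(x)=1$ for every $a>0$. $F\in\mathcal{D}$ (dominatedly varying) if $\limsup_{x\to\infty}\overline F(bx)/\overline F(x)<\infty$ for some (equivalently all) $b\in(0,1)$. Two-dimensional classes: let $(X,Y)$ have marginal distributions $F,G$. We write $(X,Y)\in\mathcal{L}^{(2)}$ if $F,G\in\mathcal{L}$ and $\lim_{x\wedge y\to\infty}\mathbf{P}[X>x-a_1,Y>y-a_2]/\mathbf{P}[X>x,Y>y]=1$ for every $(a_1,a_2)\in[0,\infty)^2\setminus\{(0,0)\}$. We write $(X,Y)\in\mathcal{D}^{(2)}$ if $F,G\in\mathcal{D}$ and $\limsup_{x\wedge y\to\infty}\mathbf{P}[X>b_1x,Y>b_2y]/\mathbf{P}[X>x,Y>y]<\infty$ for some (equivalently all) $(b_1,b_2)\in(0,1)^2$.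 Finally $(\mathcal{D}\cap\mathcal{L})^{(2)}=\mathcal{D}^{(2)}\cap\mathcal{L}^{(2)}$. GTAI: $X_1,\ldots,X_n,Y_1,\ldots,Y_m$ are GTAI if (1) $\lim_{\min\{x_i,x_k,y_j\}\to\infty}\mathbf{P}[|X_i|>x_i\mid X_k>x_k,Y_j>y_j]=0$ for all $1\le i\ne k\le n$, $1\le j\le m$; and (2) $\lim_{\min\{x_i,y_k,y_j\}\to\infty}\mathbf{P}[|Y_j|>y_j\mid X_i>x_i,Y_k>y_k]=0$ for all $1\le j\ne k\le m$, $1\le i\le n$. TAI: $X_1,\ldots,X_n$ are TAI if $\lim_{x_i\wedge x_j\to\infty}\mathbf{P}[|X_i|>x_i\mid X_j>x_j]=0$ for all $i\ne j$ in $\{1,\ldots,n\}$. *)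

theory Defs
  imports "HOL-Probability.Probability"
begin

text \<open>
  Limits for the minimum of several real variables tending to infinity are taken along products
  of the filter \<open>at_top\<close>; for two variables this is the following identity.
\<close>

lemma prod_at_top_eq_min_at_top:
  "(at_top :: real filter) \<times>\<^sub>F (at_top :: real filter) = filtercomap (\<lambda>(x, y). min x y) at_top"
proof (rule filter_eqI)
  fix P :: "real \<times> real \<Rightarrow> bool"
  show "eventually P (at_top \<times>\<^sub>F at_top) \<longleftrightarrow> eventually P (filtercomap (\<lambda>(x, y). min x y) at_top)"
  proof
    assume "eventually P (at_top \<times>\<^sub>F at_top)"
    then obtain Q R where *: "eventually Q at_top" "eventually R at_top"
      "\<And>x y. Q x \<Longrightarrow> R y \<Longrightarrow> P (x, y)"
      unfolding eventually_prod_filter by blast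
    then obtain a b where "\<And>x. x \<ge> a \<Longrightarrow> Q x" "\<And>y. y \<ge> b \<Longrightarrow> R y"
      unfolding eventually_at_top_linorder by blast
    then have "\<forall>x. (\<lambda>(x, y). min x y) x \<ge> max a b \<longrightarrow> P x"
      using * by auto
    then show "eventually P (filtercomap (\<lambda>(x, y). min x y) at_top)"
      unfolding eventually_filtercomap_at_top_linorder by blast
  next
    assume "eventually P (filtercomap (\<lambda>(x, y). min x y) at_top)"
    then obtain N where N: "\<And>x. (\<lambda>(x, y). min x y) x \<ge> N \<Longrightarrow> P x"
      unfolding eventually_filtercomap_at_top_linorder by blast
    show "eventually P (at_top \<times>\<^sub>F at_top)"
      unfolding eventually_prod_filter
      by (rule exI[of _ "\<lambda>x. x \<ge> N"], rule exI[of _ "\<lambda>y. y \<ge> N"])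
        (auto simp: eventually_ge_at_top intro!: N)
  qed
qed

text \<open>
  Since \<open>x / 0 = 0\<close> in HOL, each notion below states explicitly that the tails used
  as denominators or as conditioning events are positive on the nonnegative (half-)axes.
\<close>

text \<open>The one-dimensional classes are sets of distribution functions.\<close>

definition class_L :: "(real \<Rightarrow> real) set" where
  "class_L = {F. (\<forall>x\<ge>0. 1 - F x > 0) \<and>
     (\<forall>a>0. ((\<lambda>x. (1 - F (x - a)) / (1 - F x)) \<longlongrightarrow> 1) at_top)}"

definition class_D :: "(real \<Rightarrow> real) set" where
  "class_D = {F. (\<forall>x\<ge>0. 1 - F x > 0) \<and>
     (\<exists>b\<in>{0<..<1}. Limsup at_top (\<lambda>x. ereal ((1 - F (b * x)) / (1 - F x))) < \<infinity>)}"

definition joint_tail ::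
  "'a measure \<Rightarrow> ('a \<Rightarrow> real) \<Rightarrow> ('a \<Rightarrow> real) \<Rightarrow> real \<Rightarrow> real \<Rightarrow> real" where
  "joint_tail M X Y x y = \<P>(\<omega> in M. X \<omega> > x \<and> Y \<omega> > y)"

definition class_L2 :: "'a measure \<Rightarrow> (('a \<Rightarrow> real) \<times> ('a \<Rightarrow> real)) set" where
  "class_L2 M = {(X, Y).
     cdf (distr M borel X) \<in> class_L \<and> cdf (distr M borel Y) \<in> class_L \<and>
     (\<forall>x\<ge>0. \<forall>y\<ge>0. joint_tail M X Y x y > 0) \<and>
     (\<forall>a1\<ge>0. \<forall>a2\<ge>0. (a1, a2) \<noteq> (0, 0) \<longrightarrow>
        ((\<lambda>(x, y). joint_tail M X Y (x - a1) (y - a2) / joint_tail M X Y x y) \<longlongrightarrow> 1)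
          (at_top \<times>\<^sub>F at_top))}"

definition class_D2 :: "'a measure \<Rightarrow> (('a \<Rightarrow> real) \<times> ('a \<Rightarrow> real)) set" where
  "class_D2 M = {(X, Y).
     cdf (distr M borel X) \<in> class_D \<and> cdf (distr M borel Y) \<in> class_D \<and>
     (\<forall>x\<ge>0. \<forall>y\<ge>0. joint_tail M X Y x y > 0) \<and>
     (\<exists>b1\<in>{0<..<1}. \<exists>b2\<in>{0<..<1}.
        Limsup (at_top \<times>\<^sub>F at_top)
          (\<lambda>(x, y). ereal (joint_tail M X Y (b1 * x) (b2 * y) / joint_tail M X Y x y)) < \<infinity>)}"

definition class_DL2 :: "'a measure \<Rightarrow> (('a \<Rightarrow> real) \<times> ('a \<Rightarrow> real)) set" where
  "class_DL2 M = class_D2 M \<inter> class_L2 M"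

definition GTAI ::
  "'a measure \<Rightarrow> nat \<Rightarrow> (nat \<Rightarrow> 'a \<Rightarrow> real) \<Rightarrow> nat \<Rightarrow> (nat \<Rightarrow> 'a \<Rightarrow> real) \<Rightarrow> bool" where
  "GTAI M n X m Y \<longleftrightarrow>
     (\<forall>i\<in>{1..n}. \<forall>k\<in>{1..n}. \<forall>j\<in>{1..m}. i \<noteq> k \<longrightarrow>
        (\<forall>x\<ge>0. \<forall>y\<ge>0. joint_tail M (X k) (Y j) x y > 0) \<and>
        ((\<lambda>(xi, xk, yj). \<P>(\<omega> in M. \<bar>X i \<omega>\<bar> > xi \<bar> X k \<omega> > xk \<and> Y j \<omega> > yj)) \<longlongrightarrow> 0)
          (at_top \<times>\<^sub>F at_top \<times>\<^sub>F at_top)) \<and>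
     (\<forall>j\<in>{1..m}. \<forall>k\<in>{1..m}. \<forall>i\<in>{1..n}. j \<noteq> k \<longrightarrow>
        (\<forall>x\<ge>0. \<forall>y\<ge>0. joint_tail M (X i) (Y k) x y > 0) \<and>
        ((\<lambda>(xi, yk, yj). \<P>(\<omega> in M. \<bar>Y j \<omega>\<bar> > yj \<bar> X i \<omega> > xi \<and> Y k \<omega> > yk)) \<longlongrightarrow> 0)
          (at_top \<times>\<^sub>F at_top \<times>\<^sub>F at_top))"

definition TAI :: "'a measure \<Rightarrow> nat \<Rightarrow> (nat \<Rightarrow> 'a \<Rightarrow> real) \<Rightarrow> bool" where
  "TAI M n X \<longleftrightarrow>
     (\<forall>i\<in>{1..n}. \<forall>j\<in>{1..n}. i \<noteq> j \<longrightarrow>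
        (\<forall>x\<ge>0. \<P>(\<omega> in M. X j \<omega> > x) > 0) \<and>
        ((\<lambda>(xi, xj). \<P>(\<omega> in M. \<bar>X i \<omega>\<bar> > xi \<bar> X j \<omega> > xj)) \<longlongrightarrow> 0) (at_top \<times>\<^sub>F at_top))"

definition weighted_sum :: "(nat \<Rightarrow> 'a \<Rightarrow> real) \<Rightarrow> (nat \<Rightarrow> 'a \<Rightarrow> real) \<Rightarrow> nat \<Rightarrow> 'a \<Rightarrow> real" where
  "weighted_sum \<Theta> X i \<omega> = (\<Sum>k=1..i. \<Theta> k \<omega> * X k \<omega>)"

end

theory Submission
  imports Defs
begin

text \<open>
  The tail classes, GTAI and the asymptotic equivalences all speak about ratios of tails. Since
  the denominators are positive and tails are monotone, each of them is equivalent to an inequality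
  that holds eventually: with \<open>f x y\<close> for the joint tail \<open>P(X > x, Y > y)\<close>,
  long-tailedness says that \<open>f (x - a) (y - b) \<le> (1 + \<epsilon>) f x y\<close>, dominated variation that
  \<open>f (c x) (d y) \<le> C f x y\<close>, and GTAI that the event that a third
  variable exceeds a high level as well has probability at most \<open>\<epsilon> f x y\<close>.

  \<^bold>\<open>Products.\<close> As \<open>\<Theta>\<close> lies between \<open>\<xi>\<close> and \<open>\<delta>\<close>, the event \<open>\<Theta> X > x\<close> lies between
  \<open>X > x / \<xi>\<close> and \<open>X > x / \<delta>\<close>. Dominated variation makes the probabilities of these two
  events comparable up to a constant, so it passes to the products (\<open>scaling_bounded_sandwich\<close>), and
  so does GTAI, where a constant factor is harmless
  (\<open>tail_negligible_rescale\<close>, \<open>GTAI_left_weighted\<close>). Long-tailedness asks for a factor close to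
  one; this is where independence enters. Given \<open>\<Theta> = \<theta>\<close>, the shift \<open>a\<close> of \<open>\<theta> X\<close> is a shift
  of \<open>X\<close> by \<open>a / \<theta> \<le> a / \<xi>\<close>, so the inequality holds uniformly in \<open>\<theta>\<close> and survives
  integration over the law of the weights (\<open>indep_section_mono\<close>, \<open>shift_insensitive_mixture\<close>).

  \<^bold>\<open>Sums and maxima.\<close> Let \<open>Z\<close> and \<open>W\<close> be the two families of products. The event that both
  maxima are large is the union of the events \<open>Z\<^sub>k > x, W\<^sub>l > y\<close>. Two of these intersect
  only if a third variable is large, so the intersections are negligible against either event
  and a Bonferroni bound gives the double sum (\<open>max_lower\<close>). The partial sums are almost surely
  increasing, so the maximum of the sums is the last sum, and it is at least the maximum.
  Conversely, if a sum of \<open>n\<close> terms exceeds \<open>x\<close>, then either one term exceeds \<open>x - a\<close>, or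
  one term exceeds \<open>x / n\<close> and another one exceeds \<open>a / n\<close> (\<open>sum_exceeds_cases\<close>).
  The first alternative contributes at most \<open>1 + \<epsilon>\<close> times the double sum, because the tails
  are long. The second is a triple event; its probability is at most \<open>\<epsilon>\<close> times the tail
  at \<open>(x / n, y / n)\<close> as soon as the fixed number \<open>a\<close> is large enough, and by dominated
  variation that tail is comparable to the tail at \<open>(x, y)\<close> (\<open>excess_cover_bound\<close>).
\<close>

section \<open>Limits of ratios as eventual inequalities\<close>

lemma eventually_at_top2:
  fixes P :: "real \<times> real \<Rightarrow> bool"
  shows "eventually P (at_top \<times>\<^sub>F at_top) \<longleftrightarrow> (\<exists>N. \<forall>x\<ge>N. \<forall>y\<ge>N. P (x, y))"
  unfolding prod_at_top_eq_min_at_top eventually_filtercomap_at_top_linorder by auto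

lemma eventually_at_top2I:
  fixes N :: real
  assumes "\<And>x y. x \<ge> N \<Longrightarrow> y \<ge> N \<Longrightarrow> P x y"
  shows "\<forall>\<^sub>F (x, y) in at_top \<times>\<^sub>F at_top. P x y"
  using assms unfolding eventually_at_top2 by auto

lemma eventually_at_top3:
  fixes P :: "real \<times> real \<times> real \<Rightarrow> bool"
  shows "eventually P (at_top \<times>\<^sub>F at_top \<times>\<^sub>F at_top) \<longleftrightarrow>
    (\<exists>N. \<forall>x\<ge>N. \<forall>y\<ge>N. \<forall>z\<ge>N. P (x, y, z))"
proof
  assume "eventually P (at_top \<times>\<^sub>F at_top \<times>\<^sub>F at_top)"
  then obtain Q R where *: "eventually Q at_top" "eventually R (at_top \<times>\<^sub>F at_top)"
    "\<And>x p. Q x \<Longrightarrow> R p \<Longrightarrow> P (x, p)"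
    unfolding eventually_prod_filter by blast
  then obtain a b where "\<And>x. x \<ge> a \<Longrightarrow> Q x" "\<And>y z. y \<ge> b \<Longrightarrow> z \<ge> b \<Longrightarrow> R (y, z)"
    unfolding eventually_at_top2 eventually_at_top_linorder by blast
  then have "\<forall>x\<ge>max a b. \<forall>y\<ge>max a b. \<forall>z\<ge>max a b. P (x, y, z)"
    using *(3) by auto
  then show "\<exists>N. \<forall>x\<ge>N. \<forall>y\<ge>N. \<forall>z\<ge>N. P (x, y, z)" by blast
next
  assume "\<exists>N. \<forall>x\<ge>N. \<forall>y\<ge>N. \<forall>z\<ge>N. P (x, y, z)"
  then obtain N where N: "\<And>x y z. x \<ge> N \<Longrightarrow> y \<ge> N \<Longrightarrow> z \<ge> N \<Longrightarrow> P (x, y, z)" by blast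
  have "eventually (\<lambda>p. fst p \<ge> N \<and> snd p \<ge> N) (at_top \<times>\<^sub>F (at_top :: real filter))"
    unfolding eventually_at_top2 by auto
  then show "eventually P (at_top \<times>\<^sub>F at_top \<times>\<^sub>F at_top)"
    unfolding eventually_prod_filter
    by (intro exI[of _ "\<lambda>x. x \<ge> N"] exI[of _ "\<lambda>p. fst p \<ge> N \<and> snd p \<ge> N"])
      (auto simp: eventually_ge_at_top intro!: N)
qed

lemma eventually_at_top2_fst:
  fixes P :: "real \<Rightarrow> bool"
  shows "(\<forall>\<^sub>F (x, y) in at_top \<times>\<^sub>F (at_top :: real filter). P x) \<longleftrightarrow> (\<forall>\<^sub>F x in at_top. P x)"
  unfolding eventually_at_top2 eventually_at_top_linorder by auto

text \<open>
  Numerators that dominate the denominator can only approach the ratio one from above, so a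
  one-sided estimate is enough. This covers both long-tailedness conditions, since a tail
  increases when its argument is shifted down.
\<close>
lemma tendsto_ratio_1_iff:
  fixes f g :: "'b \<Rightarrow> real"
  assumes g: "\<forall>\<^sub>F p in \<F>. 0 < g p" and fg: "\<forall>\<^sub>F p in \<F>. g p \<le> f p"
  shows "((\<lambda>p. f p / g p) \<longlongrightarrow> 1) \<F> \<longleftrightarrow> (\<forall>\<epsilon>>0. \<forall>\<^sub>F p in \<F>. f p \<le> (1 + \<epsilon>) * g p)"
proof (intro iffI allI impI)
  fix \<epsilon> :: real assume "((\<lambda>p. f p / g p) \<longlongrightarrow> 1) \<F>" "\<epsilon> > 0"
  then have "\<forall>\<^sub>F p in \<F>. f p / g p < 1 + \<epsilon>" by (intro order_tendstoD(2)) auto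
  with g show "\<forall>\<^sub>F p in \<F>. f p \<le> (1 + \<epsilon>) * g p"
    by eventually_elim (simp add: field_simps)
next
  assume *: "\<forall>\<epsilon>>0. \<forall>\<^sub>F p in \<F>. f p \<le> (1 + \<epsilon>) * g p"
  show "((\<lambda>p. f p / g p) \<longlongrightarrow> 1) \<F>"
  proof (rule order_tendstoI)
    fix a :: real assume "a < 1"
    show "\<forall>\<^sub>F p in \<F>. a < f p / g p"
      using g fg
    proof eventually_elim
      case (elim p)
      then have "1 \<le> f p / g p" by simp
      with \<open>a < 1\<close> show ?case by linarith
    qed
  next
    fix a :: real assume "1 < a"
    then have "\<forall>\<^sub>F p in \<F>. f p \<le> (1 + (a - 1) / 2) * g p" using * by simp
    with g show "\<forall>\<^sub>F p in \<F>. f p / g p < a"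
    proof eventually_elim
      case (elim p)
      then have "f p / g p \<le> 1 + (a - 1) / 2" by (simp add: divide_le_eq)
      also have "1 + (a - 1) / 2 < a" using \<open>1 < a\<close> by (simp add: field_simps)
      finally show ?case .
    qed
  qed
qed

lemma tendsto_ratio_0_iff:
  fixes f g :: "'b \<Rightarrow> real"
  assumes g: "\<forall>\<^sub>F p in \<F>. 0 < g p" and f: "\<forall>\<^sub>F p in \<F>. 0 \<le> f p"
  shows "((\<lambda>p. f p / g p) \<longlongrightarrow> 0) \<F> \<longleftrightarrow> (\<forall>\<epsilon>>0. \<forall>\<^sub>F p in \<F>. f p \<le> \<epsilon> * g p)"
proof (intro iffI allI impI)
  fix \<epsilon> :: real assume "((\<lambda>p. f p / g p) \<longlongrightarrow> 0) \<F>" "\<epsilon> > 0"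
  then have "\<forall>\<^sub>F p in \<F>. f p / g p < \<epsilon>" by (intro order_tendstoD(2)) auto
  with g show "\<forall>\<^sub>F p in \<F>. f p \<le> \<epsilon> * g p"
    by eventually_elim (simp add: field_simps)
next
  assume *: "\<forall>\<epsilon>>0. \<forall>\<^sub>F p in \<F>. f p \<le> \<epsilon> * g p"
  show "((\<lambda>p. f p / g p) \<longlongrightarrow> 0) \<F>"
  proof (rule order_tendstoI)
    fix a :: real assume "a < 0"
    show "\<forall>\<^sub>F p in \<F>. a < f p / g p"
      using g f
    proof eventually_elim
      case (elim p)
      then have "0 \<le> f p / g p" by simp
      with \<open>a < 0\<close> show ?case by linarith
    qed
  next
    fix a :: real assume "0 < a"
    then have "\<forall>\<^sub>F p in \<F>. f p \<le> (a / 2) * g p" using * half_gt_zero by blast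
    with g show "\<forall>\<^sub>F p in \<F>. f p / g p < a"
    proof eventually_elim
      case (elim p)
      then have "f p / g p \<le> a / 2" by (simp add: divide_le_eq)
      also have "a / 2 < a" using \<open>0 < a\<close> by simp
      finally show ?case .
    qed
  qed
qed

lemma Limsup_ratio_finite_iff:
  fixes f g :: "'b \<Rightarrow> real"
  assumes g: "\<forall>\<^sub>F p in \<F>. 0 < g p"
  shows "Limsup \<F> (\<lambda>p. ereal (f p / g p)) < \<infinity> \<longleftrightarrow> (\<exists>C>0. \<forall>\<^sub>F p in \<F>. f p \<le> C * g p)"
proof
  assume "Limsup \<F> (\<lambda>p. ereal (f p / g p)) < \<infinity>"
  then obtain C where C: "Limsup \<F> (\<lambda>p. ereal (f p / g p)) < ereal C"
    using ereal_dense2 by blast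
  have "\<forall>\<^sub>F p in \<F>. f p \<le> max C 1 * g p"
    using Limsup_lessD[OF C] g
  proof eventually_elim
    case (elim p)
    then have "f p \<le> C * g p" by (simp add: field_simps)
    also have "\<dots> \<le> max C 1 * g p" using elim by (intro mult_right_mono) auto
    finally show ?case .
  qed
  then show "\<exists>C>0. \<forall>\<^sub>F p in \<F>. f p \<le> C * g p" by (intro exI[of _ "max C 1"]) auto
next
  assume "\<exists>C>0. \<forall>\<^sub>F p in \<F>. f p \<le> C * g p"
  then obtain C where "\<forall>\<^sub>F p in \<F>. f p \<le> C * g p" by blast
  with g have "\<forall>\<^sub>F p in \<F>. ereal (f p / g p) \<le> ereal C"
    by eventually_elim (simp add: field_simps)
  then have "Limsup \<F> (\<lambda>p. ereal (f p / g p)) \<le> ereal C" by (rule Limsup_bounded)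
  then show "Limsup \<F> (\<lambda>p. ereal (f p / g p)) < \<infinity>" by (rule le_less_trans) simp
qed

lemma asymp_equiv_if_close:
  fixes f g :: "'b \<Rightarrow> real"
  assumes g: "\<forall>\<^sub>F p in \<F>. 0 < g p"
    and lower: "\<And>\<epsilon>. \<epsilon> > 0 \<Longrightarrow> \<forall>\<^sub>F p in \<F>. (1 - \<epsilon>) * g p \<le> f p"
    and upper: "\<And>\<epsilon>. \<epsilon> > 0 \<Longrightarrow> \<forall>\<^sub>F p in \<F>. f p \<le> (1 + \<epsilon>) * g p"
  shows "f \<sim>[\<F>] g"
proof (rule asymp_equivI', rule tendstoI)
  fix e :: real assume "e > 0"
  then have "e / 2 > 0" by simp
  from g lower[OF this] upper[OF this] show "\<forall>\<^sub>F p in \<F>. dist (f p / g p) 1 < e"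
  proof eventually_elim
    case (elim p)
    then have "1 - e / 2 \<le> f p / g p" "f p / g p \<le> 1 + e / 2"
      by (auto simp: pos_le_divide_eq pos_divide_le_eq)
    with \<open>e > 0\<close> show ?case by (simp add: dist_real_def abs_if)
  qed
qed

section \<open>Shifting and rescaling the arguments of bivariate tails\<close>

text \<open>
  The two properties below express long-tailedness and dominated variation. The
  one-dimensional classes are included as functions that ignore their second argument, so that
  each closure argument is given once for marginal and joint tails.
\<close>
definition shift_insensitive :: "(real \<Rightarrow> real \<Rightarrow> real) \<Rightarrow> bool" where
  "shift_insensitive f \<longleftrightarrow> (\<forall>a\<ge>0. \<forall>b\<ge>0. \<forall>\<epsilon>>0.
     \<forall>\<^sub>F (x, y) in at_top \<times>\<^sub>F at_top. f (x - a) (y - b) \<le> (1 + \<epsilon>) * f x y)"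

definition scaling_bounded :: "(real \<Rightarrow> real \<Rightarrow> real) \<Rightarrow> bool" where
  "scaling_bounded f \<longleftrightarrow> (\<forall>c>0. \<forall>d>0. \<exists>C>0.
     \<forall>\<^sub>F (x, y) in at_top \<times>\<^sub>F at_top. f (c * x) (d * y) \<le> C * f x y)"

text \<open>
  One pair of contraction factors suffices: iterating the bound \<open>m\<close> times replaces \<open>b\<close> by
  \<open>b ^ m\<close> and \<open>C\<close> by \<open>C ^ m\<close>, and \<open>b ^ m\<close> is eventually below any given positive factor.
\<close>
lemma scaling_boundedI:
  fixes f :: "real \<Rightarrow> real \<Rightarrow> real"
  assumes anti: "\<And>x x' y y'. x \<le> x' \<Longrightarrow> y \<le> y' \<Longrightarrow> f x' y' \<le> f x y"
    and b: "0 < b1" "b1 < 1" "0 < b2" "b2 < 1" and C: "C > 0"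
    and bound: "\<forall>\<^sub>F (x, y) in at_top \<times>\<^sub>F at_top. f (b1 * x) (b2 * y) \<le> C * f x y"
  shows "scaling_bounded f"
proof -
  obtain N where N: "\<And>x y. x \<ge> N \<Longrightarrow> y \<ge> N \<Longrightarrow> f (b1 * x) (b2 * y) \<le> C * f x y"
    using bound unfolding eventually_at_top2 by auto
  have iter: "\<exists>K. \<forall>x\<ge>K. \<forall>y\<ge>K. f (b1 ^ m * x) (b2 ^ m * y) \<le> C ^ m * f x y" for m
  proof (induction m)
    case (Suc m)
    then obtain K where K: "\<And>x y. x \<ge> K \<Longrightarrow> y \<ge> K \<Longrightarrow> f (b1 ^ m * x) (b2 ^ m * y) \<le> C ^ m * f x y"
      by blast
    have "f (b1 ^ Suc m * x) (b2 ^ Suc m * y) \<le> C ^ Suc m * f x y"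
      if "x \<ge> max K (max (N / b1 ^ m) (N / b2 ^ m))" "y \<ge> max K (max (N / b1 ^ m) (N / b2 ^ m))" for x y
    proof -
      have "N \<le> b1 ^ m * x" "N \<le> b2 ^ m * y" "K \<le> x" "K \<le> y"
        using that b by (auto simp: field_simps)
      then have "f (b1 * (b1 ^ m * x)) (b2 * (b2 ^ m * y)) \<le> C * (C ^ m * f x y)"
        using N K C by (meson mult_left_mono order.trans less_imp_le)
      then show ?thesis by (simp add: mult.assoc)
    qed
    then show ?case by blast
  qed auto
  show ?thesis
    unfolding scaling_bounded_def
  proof (intro allI impI)
    fix c d :: real assume cd: "c > 0" "d > 0"
    obtain m1 where m1: "b1 ^ m1 < c" using real_arch_pow_inv[of c b1] cd b by auto
    obtain m2 where m2: "b2 ^ m2 < d" using real_arch_pow_inv[of d b2] cd b by auto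
    define m where "m = max m1 m2"
    have "b1 ^ m \<le> b1 ^ m1" "b2 ^ m \<le> b2 ^ m2" using b by (auto intro!: power_decreasing simp: m_def)
    with m1 m2 have m: "b1 ^ m \<le> c" "b2 ^ m \<le> d" by auto
    obtain K where K: "\<And>x y. x \<ge> K \<Longrightarrow> y \<ge> K \<Longrightarrow> f (b1 ^ m * x) (b2 ^ m * y) \<le> C ^ m * f x y"
      using iter by blast
    have "f (c * x) (d * y) \<le> C ^ m * f x y" if "x \<ge> max K 0" "y \<ge> max K 0" for x y
    proof -
      have "f (c * x) (d * y) \<le> f (b1 ^ m * x) (b2 ^ m * y)"
        using m that by (intro anti mult_right_mono) auto
      also have "\<dots> \<le> C ^ m * f x y" using K that by auto
      finally show ?thesis .
    qed
    then have "\<forall>\<^sub>F (x, y) in at_top \<times>\<^sub>F at_top. f (c * x) (d * y) \<le> C ^ m * f x y"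
      by (rule eventually_at_top2I)
    then show "\<exists>C>0. \<forall>\<^sub>F (x, y) in at_top \<times>\<^sub>F at_top. f (c * x) (d * y) \<le> C * f x y"
      using C by (intro exI[of _ "C ^ m"]) auto
  qed
qed

lemma scaling_bounded_sandwich:
  assumes f: "scaling_bounded f"
    and pos: "0 < \<xi>" "0 < \<delta>" "0 < \<gamma>" "0 < \<zeta>"
    and lower: "\<And>x y. x \<ge> 0 \<Longrightarrow> y \<ge> 0 \<Longrightarrow> f (x / \<xi>) (y / \<gamma>) \<le> g x y"
    and upper: "\<And>x y. x \<ge> 0 \<Longrightarrow> y \<ge> 0 \<Longrightarrow> g x y \<le> f (x / \<delta>) (y / \<zeta>)"
  shows "scaling_bounded g"
  unfolding scaling_bounded_def
proof (intro allI impI)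
  fix c d :: real assume cd: "c > 0" "d > 0"
  obtain C N where C: "C > 0"
    and N: "\<And>x y. x \<ge> N \<Longrightarrow> y \<ge> N \<Longrightarrow> f (c * \<xi> / \<delta> * x) (d * \<gamma> / \<zeta> * y) \<le> C * f x y"
  proof -
    have "c * \<xi> / \<delta> > 0" "d * \<gamma> / \<zeta> > 0" using cd pos by auto
    with f obtain C where "C > 0"
      "\<forall>\<^sub>F (x, y) in at_top \<times>\<^sub>F at_top. f (c * \<xi> / \<delta> * x) (d * \<gamma> / \<zeta> * y) \<le> C * f x y"
      unfolding scaling_bounded_def by meson
    then show ?thesis using that unfolding eventually_at_top2 by auto
  qed
  have "g (c * x) (d * y) \<le> C * g x y" if "x \<ge> max 0 (max (N * \<xi>) (N * \<gamma>))" "y \<ge> max 0 (max (N * \<xi>) (N * \<gamma>))" for x y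
  proof -
    have xy: "x \<ge> 0" "y \<ge> 0" "x / \<xi> \<ge> N" "y / \<gamma> \<ge> N" using that pos by (auto simp: field_simps)
    have "g (c * x) (d * y) \<le> f (c * x / \<delta>) (d * y / \<zeta>)" using cd xy by (intro upper) auto
    also have "\<dots> = f (c * \<xi> / \<delta> * (x / \<xi>)) (d * \<gamma> / \<zeta> * (y / \<gamma>))" using pos by simp
    also have "\<dots> \<le> C * f (x / \<xi>) (y / \<gamma>)" using N xy by blast
    also have "\<dots> \<le> C * g x y" using lower xy C by simp
    finally show ?thesis .
  qed
  then have "\<forall>\<^sub>F (x, y) in at_top \<times>\<^sub>F at_top. g (c * x) (d * y) \<le> C * g x y"
    by (rule eventually_at_top2I)
  with C show "\<exists>C>0. \<forall>\<^sub>F (x, y) in at_top \<times>\<^sub>F at_top. g (c * x) (d * y) \<le> C * g x y" by blast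
qed

lemma scaling_bounded_swap:
  assumes f: "scaling_bounded f" and g: "\<And>x y. g x y = f y x"
  shows "scaling_bounded g"
  unfolding scaling_bounded_def
proof (intro allI impI)
  fix c d :: real assume "c > 0" "d > 0"
  then obtain C where "C > 0" "\<forall>\<^sub>F (x, y) in at_top \<times>\<^sub>F at_top. f (d * x) (c * y) \<le> C * f x y"
    using f unfolding scaling_bounded_def by meson
  then show "\<exists>C>0. \<forall>\<^sub>F (x, y) in at_top \<times>\<^sub>F at_top. g (c * x) (d * y) \<le> C * g x y"
    unfolding eventually_at_top2 g by auto
qed

text \<open>
  In the applications \<open>h u x y\<close> is the probability that the pair with joint tail \<open>f\<close> exceeds
  \<open>(x, y)\<close> while a third variable exceeds \<open>u\<close>. The level \<open>u\<close> is a variable of its own, so that it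
  may be held at a large constant while \<open>x\<close> and \<open>y\<close> tend to infinity.
\<close>
definition tail_negligible :: "(real \<Rightarrow> real \<Rightarrow> real \<Rightarrow> real) \<Rightarrow> (real \<Rightarrow> real \<Rightarrow> real) \<Rightarrow> bool" where
  "tail_negligible h f \<longleftrightarrow> (\<forall>\<epsilon>>0. \<exists>N. \<forall>u\<ge>N. \<forall>x\<ge>N. \<forall>y\<ge>N. h u x y \<le> \<epsilon> * f x y)"

lemma tail_negligibleD:
  "tail_negligible h f \<Longrightarrow> \<epsilon> > 0 \<Longrightarrow> \<exists>N. \<forall>u\<ge>N. \<forall>x\<ge>N. \<forall>y\<ge>N. h u x y \<le> \<epsilon> * f x y"
  unfolding tail_negligible_def by simp

lemma tail_negligible_mono:
  assumes "tail_negligible h f" "\<And>u x y. h' u x y \<le> h u x y" "\<And>x y. f x y \<le> f' x y"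
  shows "tail_negligible h' f'"
  unfolding tail_negligible_def
proof (intro allI impI)
  fix \<epsilon> :: real assume \<epsilon>: "\<epsilon> > 0"
  then obtain N where N: "\<forall>u\<ge>N. \<forall>x\<ge>N. \<forall>y\<ge>N. h u x y \<le> \<epsilon> * f x y"
    using tail_negligibleD[OF assms(1)] by presburger
  have "h' u x y \<le> \<epsilon> * f' x y" if "u \<ge> N" "x \<ge> N" "y \<ge> N" for u x y
    using N[rule_format, OF that] assms(2)[of u x y] mult_left_mono[OF assms(3)[of x y], of \<epsilon>] \<epsilon> by linarith
  then show "\<exists>N. \<forall>u\<ge>N. \<forall>x\<ge>N. \<forall>y\<ge>N. h' u x y \<le> \<epsilon> * f' x y" by blast
qed

text \<open>
  The constant \<open>C\<close> that dominated variation charges for passing from \<open>(x / p, y / q)\<close> to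
  \<open>(x / s, y / t)\<close> is known before \<open>\<epsilon>\<close> has to be spent, so the bound with \<open>\<epsilon> / C\<close> compensates it.
\<close>
lemma tail_negligible_rescale:
  assumes h: "tail_negligible h f" and f: "scaling_bounded f"
    and pos: "0 < r" "0 < p" "0 < q" "0 < s" "0 < t"
  shows "tail_negligible (\<lambda>u x y. h (u / r) (x / p) (y / q)) (\<lambda>x y. f (x / s) (y / t))"
  unfolding tail_negligible_def
proof (intro allI impI)
  fix \<epsilon> :: real assume \<epsilon>: "\<epsilon> > 0"
  have "0 < s / p" "0 < t / q" using pos by auto
  then obtain C where C: "C > 0"
    "\<forall>\<^sub>F (x, y) in at_top \<times>\<^sub>F at_top. f (s / p * x) (t / q * y) \<le> C * f x y"
    using f unfolding scaling_bounded_def by meson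
  then obtain N1 where N1: "\<And>x y. x \<ge> N1 \<Longrightarrow> y \<ge> N1 \<Longrightarrow> f (s / p * x) (t / q * y) \<le> C * f x y"
    unfolding eventually_at_top2 by auto
  have "\<epsilon> / C > 0" using \<epsilon> C(1) by simp
  then obtain N2 where N2: "\<forall>u\<ge>N2. \<forall>x\<ge>N2. \<forall>y\<ge>N2. h u x y \<le> \<epsilon> / C * f x y"
    using tail_negligibleD[OF h] by presburger
  define N where "N = max (N2 * r) (max (N2 * p) (max (N2 * q) (max (N1 * s) (N1 * t))))"
  have N: "N2 * r \<le> N" "N2 * p \<le> N" "N2 * q \<le> N" "N1 * s \<le> N" "N1 * t \<le> N"
    by (auto simp: N_def)
  have "h (u / r) (x / p) (y / q) \<le> \<epsilon> * f (x / s) (y / t)" if "u \<ge> N" "x \<ge> N" "y \<ge> N" for u x y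
  proof -
    have large: "N2 \<le> u / r" "N2 \<le> x / p" "N2 \<le> y / q" "N1 \<le> x / s" "N1 \<le> y / t"
      unfolding pos_le_divide_eq[OF pos(1)] pos_le_divide_eq[OF pos(2)] pos_le_divide_eq[OF pos(3)]
        pos_le_divide_eq[OF pos(4)] pos_le_divide_eq[OF pos(5)]
      using that N by (blast intro: order.trans)+
    have "h (u / r) (x / p) (y / q) \<le> \<epsilon> / C * f (x / p) (y / q)"
      using N2 large by simp
    also have "f (x / p) (y / q) = f (s / p * (x / s)) (t / q * (y / t))"
      using pos by simp
    also have "\<epsilon> / C * f (s / p * (x / s)) (t / q * (y / t)) \<le> \<epsilon> / C * (C * f (x / s) (y / t))"
      using large \<epsilon> C(1) by (intro mult_left_mono N1) auto
    also have "\<dots> = \<epsilon> * f (x / s) (y / t)" using C(1) by simp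
    finally show ?thesis .
  qed
  then show "\<exists>N. \<forall>u\<ge>N. \<forall>x\<ge>N. \<forall>y\<ge>N. h (u / r) (x / p) (y / q) \<le> \<epsilon> * f (x / s) (y / t)" by blast
qed

section \<open>The tail classes as eventual inequalities\<close>

context prob_space
begin

abbreviation tail :: "('a \<Rightarrow> real) \<Rightarrow> real \<Rightarrow> real" where
  "tail X x \<equiv> \<P>(\<omega> in M. X \<omega> > x)"

lemma one_minus_cdf_eq_tail:
  assumes [measurable]: "X \<in> borel_measurable M"
  shows "1 - cdf (distr M borel X) x = tail X x"
proof -
  have "cdf (distr M borel X) x = prob {\<omega>\<in>space M. X \<omega> \<le> x}"
    by (auto simp: cdf_def measure_distr intro!: arg_cong[where f = prob])
  moreover have "prob {\<omega>\<in>space M. \<not> X \<omega> \<le> x} = 1 - prob {\<omega>\<in>space M. X \<omega> \<le> x}"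
    by (rule prob_neg) measurable
  ultimately show ?thesis by (simp add: not_le)
qed

lemma tail_antimono:
  assumes [measurable]: "X \<in> borel_measurable M" and "x \<le> x'"
  shows "tail X x' \<le> tail X x"
  using assms(2) by (intro finite_measure_mono) auto

lemma joint_tail_antimono:
  assumes [measurable]: "X \<in> borel_measurable M" "Y \<in> borel_measurable M"
    and "x \<le> x'" "y \<le> y'"
  shows "joint_tail M X Y x' y' \<le> joint_tail M X Y x y"
  unfolding joint_tail_def using assms(3,4) by (intro finite_measure_mono) auto

lemma joint_tail_swap: "joint_tail M X Y x y = joint_tail M Y X y x"
  unfolding joint_tail_def by (simp add: conj_commute)

lemma cdf_in_class_L_iff:
  assumes X: "X \<in> borel_measurable M"
  shows "cdf (distr M borel X) \<in> class_L \<longleftrightarrow>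
    (\<forall>x\<ge>0. tail X x > 0) \<and> shift_insensitive (\<lambda>x _. tail X x)"
proof (cases "\<forall>x\<ge>0. tail X x > 0")
  case True
  have "((\<lambda>x. tail X (x - a) / tail X x) \<longlongrightarrow> 1) at_top \<longleftrightarrow>
    (\<forall>\<epsilon>>0. \<forall>\<^sub>F x in at_top. tail X (x - a) \<le> (1 + \<epsilon>) * tail X x)" if "a > 0" for a
  proof (rule tendsto_ratio_1_iff)
    show "\<forall>\<^sub>F x in at_top. 0 < tail X x"
      using True unfolding eventually_at_top_linorder by blast
    show "\<forall>\<^sub>F x in at_top. tail X x \<le> tail X (x - a)"
      using that X by (intro always_eventually allI tail_antimono) auto
  qed
  then have "cdf (distr M borel X) \<in> class_L \<longleftrightarrow>
    (\<forall>a>0. \<forall>\<epsilon>>0. \<forall>\<^sub>F x in at_top. tail X (x - a) \<le> (1 + \<epsilon>) * tail X x)"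
    using True unfolding class_L_def mem_Collect_eq one_minus_cdf_eq_tail[OF X] by simp
  also have "\<dots> \<longleftrightarrow> (\<forall>a\<ge>0. \<forall>\<epsilon>>0. \<forall>\<^sub>F x in at_top. tail X (x - a) \<le> (1 + \<epsilon>) * tail X x)"
  proof -
    have "\<forall>\<epsilon>>0. \<forall>\<^sub>F x in at_top. tail X (x - 0) \<le> (1 + \<epsilon>) * tail X x"
      by (auto simp: algebra_simps intro!: always_eventually)
    moreover have "(\<forall>a>0. Q a) \<longleftrightarrow> (\<forall>a\<ge>0. Q a)" if "Q 0" for Q :: "real \<Rightarrow> bool"
      using that by (auto simp: less_eq_real_def)
    ultimately show ?thesis by simp
  qed
  also have "\<dots> \<longleftrightarrow> shift_insensitive (\<lambda>x _. tail X x)"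
    unfolding shift_insensitive_def eventually_at_top2_fst by auto
  finally show ?thesis using True by simp
next
  case False
  then show ?thesis unfolding class_L_def mem_Collect_eq one_minus_cdf_eq_tail[OF X] by blast
qed

lemma cdf_in_class_D_iff:
  assumes X: "X \<in> borel_measurable M"
  shows "cdf (distr M borel X) \<in> class_D \<longleftrightarrow>
    (\<forall>x\<ge>0. tail X x > 0) \<and> scaling_bounded (\<lambda>x _. tail X x)"
proof (cases "\<forall>x\<ge>0. tail X x > 0")
  case True
  then have "\<forall>\<^sub>F x in at_top. 0 < tail X x"
    unfolding eventually_at_top_linorder by blast
  then have "Limsup at_top (\<lambda>x. ereal (tail X (b * x) / tail X x)) < \<infinity> \<longleftrightarrow>
    (\<exists>C>0. \<forall>\<^sub>F x in at_top. tail X (b * x) \<le> C * tail X x)" for b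
    by (rule Limsup_ratio_finite_iff)
  then have *: "cdf (distr M borel X) \<in> class_D \<longleftrightarrow>
    (\<exists>b\<in>{0<..<1}. \<exists>C>0. \<forall>\<^sub>F x in at_top. tail X (b * x) \<le> C * tail X x)"
    using True unfolding class_D_def mem_Collect_eq one_minus_cdf_eq_tail[OF X] by simp
  have "scaling_bounded (\<lambda>x _. tail X x)"
    if "b \<in> {0<..<1}" "C > 0" "\<forall>\<^sub>F x in at_top. tail X (b * x) \<le> C * tail X x" for b C
    using that by (intro scaling_boundedI[of "\<lambda>x _. tail X x" b b C] tail_antimono X)
      (auto simp: eventually_at_top2_fst)
  moreover have "\<exists>C>0. \<forall>\<^sub>F x in at_top. tail X (1/2 * x) \<le> C * tail X x"
    if "scaling_bounded (\<lambda>x _. tail X x)"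
    using that unfolding scaling_bounded_def eventually_at_top2_fst
    by (meson half_gt_zero_iff zero_less_one)
  moreover have "(1/2 :: real) \<in> {0<..<1}" by simp
  ultimately show ?thesis
    using True unfolding * by blast
next
  case False
  then show ?thesis unfolding class_D_def mem_Collect_eq one_minus_cdf_eq_tail[OF X] by blast
qed

lemma class_L2_iff:
  assumes X: "X \<in> borel_measurable M" and Y: "Y \<in> borel_measurable M"
  shows "(X, Y) \<in> class_L2 M \<longleftrightarrow>
    cdf (distr M borel X) \<in> class_L \<and> cdf (distr M borel Y) \<in> class_L \<and>
    (\<forall>x\<ge>0. \<forall>y\<ge>0. joint_tail M X Y x y > 0) \<and> shift_insensitive (joint_tail M X Y)"
proof (cases "\<forall>x\<ge>0. \<forall>y\<ge>0. joint_tail M X Y x y > 0")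
  case True
  have "((\<lambda>(x, y). joint_tail M X Y (x - a) (y - b) / joint_tail M X Y x y) \<longlongrightarrow> 1)
      (at_top \<times>\<^sub>F at_top) \<longleftrightarrow>
    (\<forall>\<epsilon>>0. \<forall>\<^sub>F (x, y) in at_top \<times>\<^sub>F at_top.
      joint_tail M X Y (x - a) (y - b) \<le> (1 + \<epsilon>) * joint_tail M X Y x y)"
    if "a \<ge> 0" "b \<ge> 0" for a b
    unfolding case_prod_unfold
  proof (rule tendsto_ratio_1_iff)
    show "\<forall>\<^sub>F p in at_top \<times>\<^sub>F at_top. 0 < joint_tail M X Y (fst p) (snd p)"
      using True unfolding eventually_at_top2 by auto
    show "\<forall>\<^sub>F p in at_top \<times>\<^sub>F at_top. joint_tail M X Y (fst p) (snd p)
        \<le> joint_tail M X Y (fst p - a) (snd p - b)"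
      using that X Y by (intro always_eventually allI joint_tail_antimono) auto
  qed
  moreover have "joint_tail M X Y x y \<le> (1 + \<epsilon>) * joint_tail M X Y x y" if "\<epsilon> > 0" for \<epsilon> x y
    using that by (simp add: algebra_simps joint_tail_def)
  then have "\<forall>\<^sub>F (x, y) in at_top \<times>\<^sub>F at_top.
      joint_tail M X Y (x - 0) (y - 0) \<le> (1 + \<epsilon>) * joint_tail M X Y x y" if "\<epsilon> > 0" for \<epsilon>
    using that by (auto intro!: always_eventually)
  moreover have "(\<forall>a\<ge>0. \<forall>b\<ge>0. (a, b) \<noteq> (0, 0) \<longrightarrow> Q a b) \<longleftrightarrow> (\<forall>a\<ge>0. \<forall>b\<ge>0. Q a b)"
    if "Q 0 0" for Q :: "real \<Rightarrow> real \<Rightarrow> bool"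
    using that by auto
  ultimately have "shift_insensitive (joint_tail M X Y) \<longleftrightarrow>
     (\<forall>a1\<ge>0. \<forall>a2\<ge>0. (a1, a2) \<noteq> (0, 0) \<longrightarrow>
        ((\<lambda>(x, y). joint_tail M X Y (x - a1) (y - a2) / joint_tail M X Y x y) \<longlongrightarrow> 1)
          (at_top \<times>\<^sub>F at_top))"
    unfolding shift_insensitive_def by simp
  then show ?thesis
    using True unfolding class_L2_def by simp
next
  case False
  then show ?thesis unfolding class_L2_def by fast
qed

lemma class_D2_iff:
  assumes X: "X \<in> borel_measurable M" and Y: "Y \<in> borel_measurable M"
  shows "(X, Y) \<in> class_D2 M \<longleftrightarrow>
    cdf (distr M borel X) \<in> class_D \<and> cdf (distr M borel Y) \<in> class_D \<and>
    (\<forall>x\<ge>0. \<forall>y\<ge>0. joint_tail M X Y x y > 0) \<and> scaling_bounded (joint_tail M X Y)"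
proof (cases "\<forall>x\<ge>0. \<forall>y\<ge>0. joint_tail M X Y x y > 0")
  case True
  then have pos: "\<forall>\<^sub>F p in at_top \<times>\<^sub>F at_top. 0 < joint_tail M X Y (fst p) (snd p)"
    unfolding eventually_at_top2 by auto
  let ?B = "\<lambda>b1 b2. \<exists>C>0. \<forall>\<^sub>F (x, y) in at_top \<times>\<^sub>F at_top.
      joint_tail M X Y (b1 * x) (b2 * y) \<le> C * joint_tail M X Y x y"
  have "Limsup (at_top \<times>\<^sub>F at_top)
      (\<lambda>(x, y). ereal (joint_tail M X Y (b1 * x) (b2 * y) / joint_tail M X Y x y)) < \<infinity> \<longleftrightarrow> ?B b1 b2"
    for b1 b2
    unfolding case_prod_unfold by (rule Limsup_ratio_finite_iff[OF pos])
  moreover have "(\<exists>b1\<in>{0<..<1}. \<exists>b2\<in>{0<..<1}. ?B b1 b2) \<longleftrightarrow> scaling_bounded (joint_tail M X Y)"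
  proof
    assume "\<exists>b1\<in>{0<..<1}. \<exists>b2\<in>{0<..<1}. ?B b1 b2"
    then obtain b1 b2 C where b: "b1 \<in> {0<..<1}" "b2 \<in> {0<..<1}" and C: "C > 0"
      "\<forall>\<^sub>F (x, y) in at_top \<times>\<^sub>F at_top.
        joint_tail M X Y (b1 * x) (b2 * y) \<le> C * joint_tail M X Y x y"
      by blast
    show "scaling_bounded (joint_tail M X Y)"
      by (rule scaling_boundedI[OF _ _ _ _ _ C]) (use b joint_tail_antimono[OF X Y] in auto)
  next
    assume "scaling_bounded (joint_tail M X Y)"
    then have "?B (1/2) (1/2)"
      unfolding scaling_bounded_def by (meson half_gt_zero_iff zero_less_one)
    moreover have "(1/2 :: real) \<in> {0<..<1}" by simp
    ultimately show "\<exists>b1\<in>{0<..<1}. \<exists>b2\<in>{0<..<1}. ?B b1 b2" by blast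
  qed
  ultimately show ?thesis
    using True unfolding class_D2_def by simp
next
  case False
  then show ?thesis unfolding class_D2_def by fast
qed

end

section \<open>Generalized tail asymptotic independence as two one-sided conditions\<close>

text \<open>
  The first half of GTAI. Its second half is the first half for the two families exchanged
  (\<open>GTAI_iff_GTAI_left\<close>), so closure under products needs one proof only.
\<close>
definition GTAI_left ::
  "'a measure \<Rightarrow> nat \<Rightarrow> (nat \<Rightarrow> 'a \<Rightarrow> real) \<Rightarrow> nat \<Rightarrow> (nat \<Rightarrow> 'a \<Rightarrow> real) \<Rightarrow> bool" where
  "GTAI_left M n X m Y \<longleftrightarrow>
     (\<forall>i\<in>{1..n}. \<forall>k\<in>{1..n}. \<forall>j\<in>{1..m}. i \<noteq> k \<longrightarrow>
        (\<forall>x\<ge>0. \<forall>y\<ge>0. joint_tail M (X k) (Y j) x y > 0) \<and>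
        tail_negligible (\<lambda>u x y. \<P>(\<omega> in M. \<bar>X i \<omega>\<bar> > u \<and> X k \<omega> > x \<and> Y j \<omega> > y))
          (joint_tail M (X k) (Y j)))"

context prob_space
begin

lemma cond_prob_tendsto_0_iff:
  assumes "\<forall>x\<ge>0. \<forall>y\<ge>0. joint_tail M X Y x y > 0"
  shows "((\<lambda>(u, x, y). \<P>(\<omega> in M. \<bar>U \<omega>\<bar> > u \<bar> X \<omega> > x \<and> Y \<omega> > y)) \<longlongrightarrow> 0)
      (at_top \<times>\<^sub>F at_top \<times>\<^sub>F at_top) \<longleftrightarrow>
    tail_negligible (\<lambda>u x y. \<P>(\<omega> in M. \<bar>U \<omega>\<bar> > u \<and> X \<omega> > x \<and> Y \<omega> > y)) (joint_tail M X Y)"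
    (is ?fst)
    and "((\<lambda>(x, y, u). \<P>(\<omega> in M. \<bar>U \<omega>\<bar> > u \<bar> X \<omega> > x \<and> Y \<omega> > y)) \<longlongrightarrow> 0)
      (at_top \<times>\<^sub>F at_top \<times>\<^sub>F at_top) \<longleftrightarrow>
    tail_negligible (\<lambda>u y x. \<P>(\<omega> in M. \<bar>U \<omega>\<bar> > u \<and> Y \<omega> > y \<and> X \<omega> > x)) (joint_tail M Y X)"
    (is ?snd)
proof -
  let ?h = "\<lambda>u x y. \<P>(\<omega> in M. \<bar>U \<omega>\<bar> > u \<and> X \<omega> > x \<and> Y \<omega> > y)"
  let ?g = "joint_tail M X Y"
  have cond: "\<P>(\<omega> in M. \<bar>U \<omega>\<bar> > u \<bar> X \<omega> > x \<and> Y \<omega> > y) = ?h u x y / ?g x y" for u x y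
    by (simp add: cond_prob_def joint_tail_def)
  have pos1: "\<forall>\<^sub>F p :: real \<times> real \<times> real in at_top \<times>\<^sub>F at_top \<times>\<^sub>F at_top. 0 < ?g (fst (snd p)) (snd (snd p))"
    unfolding eventually_at_top3 using assms by (intro exI[of _ 0]) auto
  have "((\<lambda>p. ?h (fst p) (fst (snd p)) (snd (snd p)) / ?g (fst (snd p)) (snd (snd p))) \<longlongrightarrow> 0)
      (at_top \<times>\<^sub>F at_top \<times>\<^sub>F at_top) \<longleftrightarrow>
    (\<forall>\<epsilon>>0. \<forall>\<^sub>F p in at_top \<times>\<^sub>F at_top \<times>\<^sub>F at_top.
      ?h (fst p) (fst (snd p)) (snd (snd p)) \<le> \<epsilon> * ?g (fst (snd p)) (snd (snd p)))"
    by (rule tendsto_ratio_0_iff[OF pos1]) simp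
  then show ?fst
    unfolding tail_negligible_def cond case_prod_unfold eventually_at_top3 by simp
  \<comment> \<open>The second half of GTAI lists its three arguments in another order; a common threshold is
    insensitive to that.\<close>
  have permute: "(\<exists>N :: real. \<forall>x\<ge>N. \<forall>y\<ge>N. \<forall>u\<ge>N. Q u x y) \<longleftrightarrow> (\<exists>N. \<forall>u\<ge>N. \<forall>y\<ge>N. \<forall>x\<ge>N. Q u x y)"
    for Q by (rule ex_cong1) auto
  have pos2: "\<forall>\<^sub>F p :: real \<times> real \<times> real in at_top \<times>\<^sub>F at_top \<times>\<^sub>F at_top. 0 < ?g (fst p) (fst (snd p))"
    unfolding eventually_at_top3 using assms by (intro exI[of _ 0]) auto
  have "((\<lambda>p. ?h (snd (snd p)) (fst p) (fst (snd p)) / ?g (fst p) (fst (snd p))) \<longlongrightarrow> 0)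
      (at_top \<times>\<^sub>F at_top \<times>\<^sub>F at_top) \<longleftrightarrow>
    (\<forall>\<epsilon>>0. \<forall>\<^sub>F p in at_top \<times>\<^sub>F at_top \<times>\<^sub>F at_top.
      ?h (snd (snd p)) (fst p) (fst (snd p)) \<le> \<epsilon> * ?g (fst p) (fst (snd p)))"
    by (rule tendsto_ratio_0_iff[OF pos2]) simp
  then have "((\<lambda>(x, y, u). ?h u x y / ?g x y) \<longlongrightarrow> 0) (at_top \<times>\<^sub>F at_top \<times>\<^sub>F at_top) \<longleftrightarrow>
    (\<forall>\<epsilon>>0. \<exists>N. \<forall>x\<ge>N. \<forall>y\<ge>N. \<forall>u\<ge>N. ?h u x y \<le> \<epsilon> * ?g x y)"
    unfolding case_prod_unfold eventually_at_top3 by simp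
  also have "\<dots> \<longleftrightarrow> (\<forall>\<epsilon>>0. \<exists>N. \<forall>u\<ge>N. \<forall>y\<ge>N. \<forall>x\<ge>N. ?h u x y \<le> \<epsilon> * ?g x y)"
    by (rule all_cong1, rule imp_cong, rule refl, rule permute)
  finally show ?snd
    unfolding tail_negligible_def cond joint_tail_swap[of Y X] by (simp add: conj_commute)
qed

lemma GTAI_iff_GTAI_left: "GTAI M n X m Y \<longleftrightarrow> GTAI_left M n X m Y \<and> GTAI_left M m Y n X"
proof -
  have "GTAI_left M n X m Y \<longleftrightarrow> (\<forall>i\<in>{1..n}. \<forall>k\<in>{1..n}. \<forall>j\<in>{1..m}. i \<noteq> k \<longrightarrow>
      (\<forall>x\<ge>0. \<forall>y\<ge>0. joint_tail M (X k) (Y j) x y > 0) \<and>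
      ((\<lambda>(xi, xk, yj). \<P>(\<omega> in M. \<bar>X i \<omega>\<bar> > xi \<bar> X k \<omega> > xk \<and> Y j \<omega> > yj)) \<longlongrightarrow> 0)
        (at_top \<times>\<^sub>F at_top \<times>\<^sub>F at_top))"
    unfolding GTAI_left_def
    by (intro ball_cong refl imp_cong conj_cong cond_prob_tendsto_0_iff(1)[symmetric])
  moreover have "GTAI_left M m Y n X \<longleftrightarrow> (\<forall>j\<in>{1..m}. \<forall>k\<in>{1..m}. \<forall>i\<in>{1..n}. j \<noteq> k \<longrightarrow>
      (\<forall>x\<ge>0. \<forall>y\<ge>0. joint_tail M (X i) (Y k) x y > 0) \<and>
      ((\<lambda>(xi, yk, yj). \<P>(\<omega> in M. \<bar>Y j \<omega>\<bar> > yj \<bar> X i \<omega> > xi \<and> Y k \<omega> > yk)) \<longlongrightarrow> 0)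
        (at_top \<times>\<^sub>F at_top \<times>\<^sub>F at_top))"
    unfolding GTAI_left_def
  proof (intro ball_cong refl imp_cong conj_cong)
    fix i k :: nat
    show "(\<forall>x\<ge>0. \<forall>y\<ge>0. 0 < joint_tail M (Y k) (X i) x y) \<longleftrightarrow>
        (\<forall>x\<ge>0. \<forall>y\<ge>0. 0 < joint_tail M (X i) (Y k) x y)"
      unfolding joint_tail_swap[of "Y k"] by blast
  qed (intro cond_prob_tendsto_0_iff(2)[symmetric])
  ultimately show ?thesis unfolding GTAI_def by simp
qed

section \<open>Multiplication by bounded independent weights\<close>

definition nonneg_rv :: "('a \<Rightarrow> real) \<Rightarrow> bool" where
  "nonneg_rv X \<longleftrightarrow> X \<in> borel_measurable M \<and> (AE \<omega> in M. 0 \<le> X \<omega>)"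

definition weight_between :: "real \<Rightarrow> real \<Rightarrow> ('a \<Rightarrow> real) \<Rightarrow> bool" where
  "weight_between \<xi> \<delta> \<Theta> \<longleftrightarrow> \<Theta> \<in> borel_measurable M \<and> 0 < \<xi> \<and> \<xi> \<le> \<delta> \<and>
    (AE \<omega> in M. \<xi> \<le> \<Theta> \<omega> \<and> \<Theta> \<omega> \<le> \<delta>)"

lemma nonneg_rv_weighted:
  assumes "nonneg_rv X" "weight_between \<xi> \<delta> \<Theta>"
  shows "nonneg_rv (\<lambda>\<omega>. \<Theta> \<omega> * X \<omega>)"
proof -
  have "AE \<omega> in M. 0 \<le> X \<omega>" "AE \<omega> in M. \<xi> \<le> \<Theta> \<omega> \<and> \<Theta> \<omega> \<le> \<delta>"
    using assms unfolding nonneg_rv_def weight_between_def by auto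
  then have "AE \<omega> in M. 0 \<le> \<Theta> \<omega> * X \<omega>"
    by eventually_elim (use assms in \<open>auto simp: weight_between_def\<close>)
  then show ?thesis using assms unfolding nonneg_rv_def weight_between_def by auto
qed

text \<open>
  The levels are quantified inside the almost-sure statement: the exceptional null set does
  not depend on \<open>x\<close>.
\<close>
lemma weighted_threshold:
  assumes "nonneg_rv X" "weight_between \<xi> \<delta> \<Theta>"
  shows "AE \<omega> in M. \<forall>x. (x / \<xi> < X \<omega> \<longrightarrow> x < \<Theta> \<omega> * X \<omega>) \<and> (x < \<Theta> \<omega> * X \<omega> \<longrightarrow> x / \<delta> < X \<omega>) \<and>
    (x < \<bar>\<Theta> \<omega> * X \<omega>\<bar> \<longrightarrow> x / \<delta> < \<bar>X \<omega>\<bar>)"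
proof -
  have "AE \<omega> in M. 0 \<le> X \<omega>" "AE \<omega> in M. \<xi> \<le> \<Theta> \<omega> \<and> \<Theta> \<omega> \<le> \<delta>"
    using assms unfolding nonneg_rv_def weight_between_def by auto
  then show ?thesis
  proof eventually_elim
    case (elim \<omega>)
    have pos: "0 < \<xi>" "0 < \<delta>" using assms(2) by (auto simp: weight_between_def)
    have "\<xi> * X \<omega> \<le> \<Theta> \<omega> * X \<omega>" "\<Theta> \<omega> * X \<omega> \<le> \<delta> * X \<omega>" "0 \<le> \<Theta> \<omega> * X \<omega>"
      using elim pos by (auto intro!: mult_right_mono)
    then show ?case
      using elim pos by (auto simp: divide_less_eq mult.commute)
  qed
qed

lemma weighted_tail_bounds:
  assumes X: "nonneg_rv X" and \<Theta>: "weight_between \<xi> \<delta> \<Theta>"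
  shows "tail X (x / \<xi>) \<le> tail (\<lambda>\<omega>. \<Theta> \<omega> * X \<omega>) x"
    and "tail (\<lambda>\<omega>. \<Theta> \<omega> * X \<omega>) x \<le> tail X (x / \<delta>)"
proof -
  note [measurable] = X[unfolded nonneg_rv_def, THEN conjunct1] \<Theta>[unfolded weight_between_def, THEN conjunct1]
  show "tail X (x / \<xi>) \<le> tail (\<lambda>\<omega>. \<Theta> \<omega> * X \<omega>) x"
  proof (rule finite_measure_mono_AE)
    show "AE \<omega> in M. \<omega> \<in> {\<omega> \<in> space M. x / \<xi> < X \<omega>} \<longrightarrow>
        \<omega> \<in> {\<omega> \<in> space M. x < \<Theta> \<omega> * X \<omega>}"
      using weighted_threshold[OF X \<Theta>] by eventually_elim auto
  qed measurable
  show "tail (\<lambda>\<omega>. \<Theta> \<omega> * X \<omega>) x \<le> tail X (x / \<delta>)"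
  proof (rule finite_measure_mono_AE)
    show "AE \<omega> in M. \<omega> \<in> {\<omega> \<in> space M. x < \<Theta> \<omega> * X \<omega>} \<longrightarrow>
        \<omega> \<in> {\<omega> \<in> space M. x / \<delta> < X \<omega>}"
      using weighted_threshold[OF X \<Theta>] by eventually_elim auto
  qed measurable
qed

lemma weighted_joint_tail_bounds:
  assumes X: "nonneg_rv X" and \<Theta>: "weight_between \<xi> \<delta> \<Theta>"
    and Y: "nonneg_rv Y" and \<Delta>: "weight_between \<gamma> \<zeta> \<Delta>"
  shows "joint_tail M X Y (x / \<xi>) (y / \<gamma>) \<le> joint_tail M (\<lambda>\<omega>. \<Theta> \<omega> * X \<omega>) (\<lambda>\<omega>. \<Delta> \<omega> * Y \<omega>) x y"
    and "joint_tail M (\<lambda>\<omega>. \<Theta> \<omega> * X \<omega>) (\<lambda>\<omega>. \<Delta> \<omega> * Y \<omega>) x y \<le> joint_tail M X Y (x / \<delta>) (y / \<zeta>)"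
proof -
  note [measurable] = X[unfolded nonneg_rv_def, THEN conjunct1] \<Theta>[unfolded weight_between_def, THEN conjunct1]
    Y[unfolded nonneg_rv_def, THEN conjunct1] \<Delta>[unfolded weight_between_def, THEN conjunct1]
  note thr = weighted_threshold[OF X \<Theta>] weighted_threshold[OF Y \<Delta>]
  show "joint_tail M X Y (x / \<xi>) (y / \<gamma>) \<le> joint_tail M (\<lambda>\<omega>. \<Theta> \<omega> * X \<omega>) (\<lambda>\<omega>. \<Delta> \<omega> * Y \<omega>) x y"
    unfolding joint_tail_def
  proof (rule finite_measure_mono_AE)
    show "AE \<omega> in M. \<omega> \<in> {\<omega> \<in> space M. x / \<xi> < X \<omega> \<and> y / \<gamma> < Y \<omega>} \<longrightarrow>
        \<omega> \<in> {\<omega> \<in> space M. x < \<Theta> \<omega> * X \<omega> \<and> y < \<Delta> \<omega> * Y \<omega>}"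
      using thr by eventually_elim auto
  qed measurable
  show "joint_tail M (\<lambda>\<omega>. \<Theta> \<omega> * X \<omega>) (\<lambda>\<omega>. \<Delta> \<omega> * Y \<omega>) x y \<le> joint_tail M X Y (x / \<delta>) (y / \<zeta>)"
    unfolding joint_tail_def
  proof (rule finite_measure_mono_AE)
    show "AE \<omega> in M. \<omega> \<in> {\<omega> \<in> space M. x < \<Theta> \<omega> * X \<omega> \<and> y < \<Delta> \<omega> * Y \<omega>} \<longrightarrow>
        \<omega> \<in> {\<omega> \<in> space M. x / \<delta> < X \<omega> \<and> y / \<zeta> < Y \<omega>}"
      using thr by eventually_elim auto
  qed measurable
qed

text \<open>
  By independence the law of \<open>(U, V)\<close> is a product measure, so the probability of an event is
  the integral of the probabilities of its sections; a bound that holds for almost every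
  section can be integrated.
\<close>
lemma indep_section_mono:
  assumes indep: "indep_var S U T V"
    and A: "A \<in> sets (S \<Otimes>\<^sub>M T)" and B: "B \<in> sets (S \<Otimes>\<^sub>M T)" and c: "c \<ge> 0"
    and le: "AE \<omega> in M. \<P>(\<omega>' in M. (U \<omega>, V \<omega>') \<in> A) \<le> c * \<P>(\<omega>' in M. (U \<omega>, V \<omega>') \<in> B)"
  shows "\<P>(\<omega> in M. (U \<omega>, V \<omega>) \<in> A) \<le> c * \<P>(\<omega> in M. (U \<omega>, V \<omega>) \<in> B)"
proof -
  have [measurable]: "U \<in> measurable M S" "V \<in> measurable M T"
    using indep by (auto dest: indep_var_rv1 indep_var_rv2)
  have prod: "distr M S U \<Otimes>\<^sub>M distr M T V = distr M (S \<Otimes>\<^sub>M T) (\<lambda>\<omega>. (U \<omega>, V \<omega>))"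
    using indep by (simp add: indep_var_distribution_eq)
  interpret V: prob_space "distr M T V" by (rule prob_space_distr) measurable
  have integrate: "emeasure M {\<omega> \<in> space M. (U \<omega>, V \<omega>) \<in> C} =
      (\<integral>\<^sup>+\<omega>. ennreal (\<P>(\<omega>' in M. (U \<omega>, V \<omega>') \<in> C)) \<partial>M)"
    and meas: "(\<lambda>\<omega>. ennreal (\<P>(\<omega>' in M. (U \<omega>, V \<omega>') \<in> C))) \<in> borel_measurable M"
    if C[measurable]: "C \<in> sets (S \<Otimes>\<^sub>M T)" for C
  proof -
    have eq: "emeasure (distr M T V) (Pair (U \<omega>) -` C) = ennreal (\<P>(\<omega>' in M. (U \<omega>, V \<omega>') \<in> C))"
      if "\<omega> \<in> space M" for \<omega>
    proof -
      have "Pair (U \<omega>) -` C \<in> sets T" using sets_Pair1[OF C] .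
      then show ?thesis
        by (subst emeasure_distr)
          (auto simp: emeasure_eq_measure intro!: arg_cong[where f = prob])
    qed
    have C': "C \<in> sets (distr M S U \<Otimes>\<^sub>M distr M T V)" unfolding prod by simp
    have "emeasure M {\<omega> \<in> space M. (U \<omega>, V \<omega>) \<in> C} = emeasure (distr M (S \<Otimes>\<^sub>M T) (\<lambda>\<omega>. (U \<omega>, V \<omega>))) C"
      by (subst emeasure_distr) (auto intro!: arg_cong[where f = "emeasure M"])
    also have "\<dots> = (\<integral>\<^sup>+u. emeasure (distr M T V) (Pair u -` C) \<partial>distr M S U)"
      unfolding prod[symmetric] by (rule V.emeasure_pair_measure_alt[OF C'])
    also have "\<dots> = (\<integral>\<^sup>+\<omega>. emeasure (distr M T V) (Pair (U \<omega>) -` C) \<partial>M)"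
      using V.measurable_emeasure_Pair[OF C'] by (subst nn_integral_distr) auto
    also have "\<dots> = (\<integral>\<^sup>+\<omega>. ennreal (\<P>(\<omega>' in M. (U \<omega>, V \<omega>') \<in> C)) \<partial>M)"
      by (intro nn_integral_cong eq)
    finally show "emeasure M {\<omega> \<in> space M. (U \<omega>, V \<omega>) \<in> C} =
      (\<integral>\<^sup>+\<omega>. ennreal (\<P>(\<omega>' in M. (U \<omega>, V \<omega>') \<in> C)) \<partial>M)" .
    have "(\<lambda>\<omega>. emeasure (distr M T V) (Pair (U \<omega>) -` C)) \<in> borel_measurable M"
      using V.measurable_emeasure_Pair[OF C'] by (rule measurable_compose[where f = U, rotated]) simp_all
    then show "(\<lambda>\<omega>. ennreal (\<P>(\<omega>' in M. (U \<omega>, V \<omega>') \<in> C))) \<in> borel_measurable M"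
      by (rule measurable_cong[THEN iffD1, rotated]) (rule eq)
  qed
  have "ennreal (\<P>(\<omega> in M. (U \<omega>, V \<omega>) \<in> A)) = (\<integral>\<^sup>+\<omega>. ennreal (\<P>(\<omega>' in M. (U \<omega>, V \<omega>') \<in> A)) \<partial>M)"
    using integrate[OF A] by (simp add: emeasure_eq_measure)
  also have "\<dots> \<le> (\<integral>\<^sup>+\<omega>. ennreal c * ennreal (\<P>(\<omega>' in M. (U \<omega>, V \<omega>') \<in> B)) \<partial>M)"
  proof (rule nn_integral_mono_AE)
    show "AE \<omega> in M. ennreal (\<P>(\<omega>' in M. (U \<omega>, V \<omega>') \<in> A))
        \<le> ennreal c * ennreal (\<P>(\<omega>' in M. (U \<omega>, V \<omega>') \<in> B))"
      using le by eventually_elim (use c in \<open>simp add: ennreal_mult[symmetric] ennreal_leI\<close>)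
  qed
  also have "\<dots> = ennreal c * (\<integral>\<^sup>+\<omega>. ennreal (\<P>(\<omega>' in M. (U \<omega>, V \<omega>') \<in> B)) \<partial>M)"
    by (rule nn_integral_cmult[OF meas[OF B]])
  also have "\<dots> = ennreal (c * \<P>(\<omega> in M. (U \<omega>, V \<omega>) \<in> B))"
    using integrate[OF B] c by (simp add: emeasure_eq_measure ennreal_mult)
  finally show ?thesis using c by simp
qed

text \<open>
  The assumption \<open>mix\<close> says that \<open>g\<close> inherits linear bounds from the conditional tails given the
  weights, which are \<open>f (x / \<Theta>) (y / \<Delta>)\<close>. A shift by \<open>a\<close> before division by \<open>\<Theta>\<close> is a
  shift by at most \<open>a / \<xi>\<close> afterwards, and \<open>x / \<Theta> \<ge> x / \<delta>\<close> ensures that the threshold from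
  which the bound for \<open>f\<close> holds is reached uniformly in the weights.
\<close>
lemma shift_insensitive_mixture:
  fixes f g :: "real \<Rightarrow> real \<Rightarrow> real"
  assumes f: "shift_insensitive f"
    and anti: "\<And>x x' y y'. x \<le> x' \<Longrightarrow> y \<le> y' \<Longrightarrow> f x' y' \<le> f x y"
    and \<Theta>: "weight_between \<xi> \<delta> \<Theta>" and \<Delta>: "weight_between \<gamma> \<zeta> \<Delta>"
    and mix: "\<And>c x x' y y'. c \<ge> 0 \<Longrightarrow>
      AE \<omega> in M. f (x' / \<Theta> \<omega>) (y' / \<Delta> \<omega>) \<le> c * f (x / \<Theta> \<omega>) (y / \<Delta> \<omega>) \<Longrightarrow> g x' y' \<le> c * g x y"
  shows "shift_insensitive g"
  unfolding shift_insensitive_def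
proof (intro allI impI)
  fix a b \<epsilon> :: real assume ab: "a \<ge> 0" "b \<ge> 0" and \<epsilon>: "\<epsilon> > 0"
  have pos: "0 < \<xi>" "0 < \<delta>" "0 < \<gamma>" "0 < \<zeta>"
    using \<Theta> \<Delta> by (auto simp: weight_between_def)
  have "\<forall>\<^sub>F (x, y) in at_top \<times>\<^sub>F at_top. f (x - a / \<xi>) (y - b / \<gamma>) \<le> (1 + \<epsilon>) * f x y"
    using f ab \<epsilon> pos unfolding shift_insensitive_def by simp
  then obtain N where N: "\<And>x y. x \<ge> N \<Longrightarrow> y \<ge> N \<Longrightarrow> f (x - a / \<xi>) (y - b / \<gamma>) \<le> (1 + \<epsilon>) * f x y"
    unfolding eventually_at_top2 by auto
  show "\<forall>\<^sub>F (x, y) in at_top \<times>\<^sub>F at_top. g (x - a) (y - b) \<le> (1 + \<epsilon>) * g x y"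
  proof (rule eventually_at_top2I)
    fix x y assume xy: "x \<ge> max 0 (max (N * \<delta>) (N * \<zeta>))" "y \<ge> max 0 (max (N * \<delta>) (N * \<zeta>))"
    have "AE \<omega> in M. \<xi> \<le> \<Theta> \<omega> \<and> \<Theta> \<omega> \<le> \<delta>" "AE \<omega> in M. \<gamma> \<le> \<Delta> \<omega> \<and> \<Delta> \<omega> \<le> \<zeta>"
      using \<Theta> \<Delta> by (auto simp: weight_between_def)
    then have "AE \<omega> in M. f ((x - a) / \<Theta> \<omega>) ((y - b) / \<Delta> \<omega>) \<le> (1 + \<epsilon>) * f (x / \<Theta> \<omega>) (y / \<Delta> \<omega>)"
    proof eventually_elim
      case (elim \<omega>)
      have "a / \<Theta> \<omega> \<le> a / \<xi>" "b / \<Delta> \<omega> \<le> b / \<gamma>" "x / \<delta> \<le> x / \<Theta> \<omega>" "y / \<zeta> \<le> y / \<Delta> \<omega>"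
        using elim ab xy pos by (auto intro!: divide_left_mono mult_pos_pos)
      moreover have "N \<le> x / \<delta>" "N \<le> y / \<zeta>" using xy pos by (auto simp: field_simps)
      ultimately have le: "x / \<Theta> \<omega> - a / \<xi> \<le> (x - a) / \<Theta> \<omega>" "y / \<Delta> \<omega> - b / \<gamma> \<le> (y - b) / \<Delta> \<omega>"
        "N \<le> x / \<Theta> \<omega>" "N \<le> y / \<Delta> \<omega>"
        by (auto simp: diff_divide_distrib)
      have "f ((x - a) / \<Theta> \<omega>) ((y - b) / \<Delta> \<omega>) \<le> f (x / \<Theta> \<omega> - a / \<xi>) (y / \<Delta> \<omega> - b / \<gamma>)"
        by (intro anti le)
      also have "\<dots> \<le> (1 + \<epsilon>) * f (x / \<Theta> \<omega>) (y / \<Delta> \<omega>)"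
        by (intro N le)
      finally show ?case .
    qed
    then show "g (x - a) (y - b) \<le> (1 + \<epsilon>) * g x y"
      using \<epsilon> by (intro mix) auto
  qed
qed

lemma less_mult_iff_divide_less: "0 < t \<Longrightarrow> x < t * v \<longleftrightarrow> x / t < v" for t x v :: real
  by (simp add: divide_less_eq mult.commute)

text \<open>
  A marginal tail is treated as a bivariate one that is constant in \<open>y\<close>, with \<open>\<Theta>\<close> as
  the weight of both coordinates.
\<close>
lemma weighted_tail_shift_insensitive:
  assumes X: "nonneg_rv X" and \<Theta>: "weight_between \<xi> \<delta> \<Theta>"
    and indep: "indep_var borel \<Theta> borel X" and L: "shift_insensitive (\<lambda>x _. tail X x)"
  shows "shift_insensitive (\<lambda>x _. tail (\<lambda>\<omega>. \<Theta> \<omega> * X \<omega>) x)"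
proof (rule shift_insensitive_mixture[OF L _ \<Theta> \<Theta>])
  have [measurable]: "X \<in> borel_measurable M" using X by (simp add: nonneg_rv_def)
  show "tail X x' \<le> tail X x" if "x \<le> x'" for x x' :: real
    using that by (rule tail_antimono[rotated]) measurable
  fix c x x' :: real
  assume c: "c \<ge> 0" and le: "AE \<omega> in M. tail X (x' / \<Theta> \<omega>) \<le> c * tail X (x / \<Theta> \<omega>)"
  define A where "A r = {p :: real \<times> real. r < fst p * snd p}" for r
  have A: "A r \<in> sets (borel \<Otimes>\<^sub>M borel)" for r
  proof -
    have "Measurable.pred (borel \<Otimes>\<^sub>M borel) (\<lambda>p :: real \<times> real. r < fst p * snd p)" by measurable
    then show ?thesis by (simp add: pred_def A_def space_pair_measure)
  qed
  have "AE \<omega> in M. \<xi> \<le> \<Theta> \<omega> \<and> \<Theta> \<omega> \<le> \<delta>" using \<Theta> by (simp add: weight_between_def)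
  with le have "AE \<omega> in M. \<P>(\<omega>' in M. (\<Theta> \<omega>, X \<omega>') \<in> A x') \<le> c * \<P>(\<omega>' in M. (\<Theta> \<omega>, X \<omega>') \<in> A x)"
  proof eventually_elim
    case (elim \<omega>)
    then have "0 < \<Theta> \<omega>" using \<Theta> by (auto simp: weight_between_def)
    then show ?case using elim(1) by (simp add: A_def less_mult_iff_divide_less)
  qed
  from indep_section_mono[OF indep A A c this]
  show "tail (\<lambda>\<omega>. \<Theta> \<omega> * X \<omega>) x' \<le> c * tail (\<lambda>\<omega>. \<Theta> \<omega> * X \<omega>) x"
    by (simp add: A_def)
qed

lemma weighted_joint_tail_shift_insensitive:
  assumes X: "nonneg_rv X" and \<Theta>: "weight_between \<xi> \<delta> \<Theta>"
    and Y: "nonneg_rv Y" and \<Delta>: "weight_between \<gamma> \<zeta> \<Delta>"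
    and indep: "indep_var (borel \<Otimes>\<^sub>M borel) (\<lambda>\<omega>. (\<Theta> \<omega>, \<Delta> \<omega>)) (borel \<Otimes>\<^sub>M borel) (\<lambda>\<omega>. (X \<omega>, Y \<omega>))"
    and L: "shift_insensitive (joint_tail M X Y)"
  shows "shift_insensitive (joint_tail M (\<lambda>\<omega>. \<Theta> \<omega> * X \<omega>) (\<lambda>\<omega>. \<Delta> \<omega> * Y \<omega>))"
proof (rule shift_insensitive_mixture[OF L _ \<Theta> \<Delta>])
  have [measurable]: "X \<in> borel_measurable M" "Y \<in> borel_measurable M"
    using X Y by (auto simp: nonneg_rv_def)
  show "joint_tail M X Y x' y' \<le> joint_tail M X Y x y" if "x \<le> x'" "y \<le> y'" for x x' y y'
    using that by (intro joint_tail_antimono) measurable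
  fix c x x' y y' :: real
  assume c: "c \<ge> 0"
    and le: "AE \<omega> in M. joint_tail M X Y (x' / \<Theta> \<omega>) (y' / \<Delta> \<omega>) \<le> c * joint_tail M X Y (x / \<Theta> \<omega>) (y / \<Delta> \<omega>)"
  define A where "A r s = {p :: (real \<times> real) \<times> (real \<times> real).
    r < fst (fst p) * fst (snd p) \<and> s < snd (fst p) * snd (snd p)}" for r s
  have A: "A r s \<in> sets ((borel \<Otimes>\<^sub>M borel) \<Otimes>\<^sub>M (borel \<Otimes>\<^sub>M borel))" for r s
  proof -
    have "Measurable.pred ((borel \<Otimes>\<^sub>M borel) \<Otimes>\<^sub>M (borel \<Otimes>\<^sub>M borel))
      (\<lambda>p :: (real \<times> real) \<times> (real \<times> real). r < fst (fst p) * fst (snd p) \<and> s < snd (fst p) * snd (snd p))"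
      by measurable
    then show ?thesis by (simp add: pred_def A_def space_pair_measure)
  qed
  have "AE \<omega> in M. \<xi> \<le> \<Theta> \<omega> \<and> \<Theta> \<omega> \<le> \<delta>" "AE \<omega> in M. \<gamma> \<le> \<Delta> \<omega> \<and> \<Delta> \<omega> \<le> \<zeta>"
    using \<Theta> \<Delta> by (auto simp: weight_between_def)
  with le have "AE \<omega> in M. \<P>(\<omega>' in M. ((\<Theta> \<omega>, \<Delta> \<omega>), (X \<omega>', Y \<omega>')) \<in> A x' y')
      \<le> c * \<P>(\<omega>' in M. ((\<Theta> \<omega>, \<Delta> \<omega>), (X \<omega>', Y \<omega>')) \<in> A x y)"
  proof eventually_elim
    case (elim \<omega>)
    then have "0 < \<Theta> \<omega>" "0 < \<Delta> \<omega>" using \<Theta> \<Delta> by (auto simp: weight_between_def)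
    then show ?case using elim(1) by (simp add: A_def less_mult_iff_divide_less joint_tail_def)
  qed
  from indep_section_mono[OF indep A A c this]
  show "joint_tail M (\<lambda>\<omega>. \<Theta> \<omega> * X \<omega>) (\<lambda>\<omega>. \<Delta> \<omega> * Y \<omega>) x' y'
      \<le> c * joint_tail M (\<lambda>\<omega>. \<Theta> \<omega> * X \<omega>) (\<lambda>\<omega>. \<Delta> \<omega> * Y \<omega>) x y"
    by (simp add: A_def joint_tail_def)
qed

lemma weighted_cdf_in_class_DL:
  assumes X: "nonneg_rv X" and \<Theta>: "weight_between \<xi> \<delta> \<Theta>"
    and indep: "indep_var borel \<Theta> borel X"
    and cl: "cdf (distr M borel X) \<in> class_D \<inter> class_L"
  shows "cdf (distr M borel (\<lambda>\<omega>. \<Theta> \<omega> * X \<omega>)) \<in> class_D \<inter> class_L"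
proof -
  let ?Z = "\<lambda>\<omega>. \<Theta> \<omega> * X \<omega>"
  have mX: "X \<in> borel_measurable M" and mZ: "?Z \<in> borel_measurable M"
    using X nonneg_rv_weighted[OF X \<Theta>] by (auto simp: nonneg_rv_def)
  have pos: "0 < \<xi>" "0 < \<delta>" using \<Theta> by (auto simp: weight_between_def)
  have L: "shift_insensitive (\<lambda>x _. tail X x)" and D: "scaling_bounded (\<lambda>x _. tail X x)"
    and tp: "\<forall>x\<ge>0. tail X x > 0"
    using cl cdf_in_class_L_iff[OF mX] cdf_in_class_D_iff[OF mX] by auto
  have "\<forall>x\<ge>0. tail ?Z x > 0"
  proof (intro allI impI)
    fix x :: real assume "x \<ge> 0"
    then have "0 < tail X (x / \<xi>)" using tp pos by simp
    also have "\<dots> \<le> tail ?Z x" by (rule weighted_tail_bounds[OF X \<Theta>])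
    finally show "0 < tail ?Z x" .
  qed
  moreover have "scaling_bounded (\<lambda>x _. tail ?Z x)"
    by (rule scaling_bounded_sandwich[OF D pos pos]) (rule weighted_tail_bounds[OF X \<Theta>])+
  ultimately show ?thesis
    using weighted_tail_shift_insensitive[OF X \<Theta> indep L]
      cdf_in_class_L_iff[OF mZ] cdf_in_class_D_iff[OF mZ] by auto
qed

lemma weighted_in_class_DL2:
  assumes X: "nonneg_rv X" and \<Theta>: "weight_between \<xi> \<delta> \<Theta>"
    and Y: "nonneg_rv Y" and \<Delta>: "weight_between \<gamma> \<zeta> \<Delta>"
    and indep: "indep_var (borel \<Otimes>\<^sub>M borel) (\<lambda>\<omega>. (\<Theta> \<omega>, \<Delta> \<omega>)) (borel \<Otimes>\<^sub>M borel) (\<lambda>\<omega>. (X \<omega>, Y \<omega>))"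
    and cl: "(X, Y) \<in> class_DL2 M"
  shows "(\<lambda>\<omega>. \<Theta> \<omega> * X \<omega>, \<lambda>\<omega>. \<Delta> \<omega> * Y \<omega>) \<in> class_DL2 M"
proof -
  let ?Z = "\<lambda>\<omega>. \<Theta> \<omega> * X \<omega>" and ?W = "\<lambda>\<omega>. \<Delta> \<omega> * Y \<omega>"
  have mX: "X \<in> borel_measurable M" "Y \<in> borel_measurable M"
    and mZ: "?Z \<in> borel_measurable M" "?W \<in> borel_measurable M"
    using X Y nonneg_rv_weighted[OF X \<Theta>] nonneg_rv_weighted[OF Y \<Delta>] by (auto simp: nonneg_rv_def)
  have pos: "0 < \<xi>" "0 < \<delta>" "0 < \<gamma>" "0 < \<zeta>" using \<Theta> \<Delta> by (auto simp: weight_between_def)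
  have D: "cdf (distr M borel X) \<in> class_D" "cdf (distr M borel Y) \<in> class_D"
    "scaling_bounded (joint_tail M X Y)" and jp: "\<forall>x\<ge>0. \<forall>y\<ge>0. joint_tail M X Y x y > 0"
    using cl class_D2_iff[OF mX] by (auto simp: class_DL2_def)
  have L: "cdf (distr M borel X) \<in> class_L" "cdf (distr M borel Y) \<in> class_L"
    "shift_insensitive (joint_tail M X Y)"
    using cl class_L2_iff[OF mX] by (auto simp: class_DL2_def)
  have i1: "indep_var borel \<Theta> borel X" and i2: "indep_var borel \<Delta> borel Y"
    using indep_var_compose[OF indep measurable_fst measurable_fst]
      indep_var_compose[OF indep measurable_snd measurable_snd] by (simp_all add: comp_def)
  have "\<forall>x\<ge>0. \<forall>y\<ge>0. joint_tail M ?Z ?W x y > 0"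
  proof (intro allI impI)
    fix x y :: real assume "x \<ge> 0" "y \<ge> 0"
    then have "0 < joint_tail M X Y (x / \<xi>) (y / \<gamma>)" using jp pos by simp
    also have "\<dots> \<le> joint_tail M ?Z ?W x y" by (rule weighted_joint_tail_bounds[OF X \<Theta> Y \<Delta>])
    finally show "0 < joint_tail M ?Z ?W x y" .
  qed
  moreover have "scaling_bounded (joint_tail M ?Z ?W)"
    by (rule scaling_bounded_sandwich[OF D(3) pos]) (rule weighted_joint_tail_bounds[OF X \<Theta> Y \<Delta>])+
  moreover have "shift_insensitive (joint_tail M ?Z ?W)"
    by (rule weighted_joint_tail_shift_insensitive[OF X \<Theta> Y \<Delta> indep L(3)])
  moreover have "cdf (distr M borel ?Z) \<in> class_D \<inter> class_L" "cdf (distr M borel ?W) \<in> class_D \<inter> class_L"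
    using weighted_cdf_in_class_DL[OF X \<Theta> i1] weighted_cdf_in_class_DL[OF Y \<Delta> i2] D L by auto
  ultimately show ?thesis
    using class_D2_iff[OF mZ] class_L2_iff[OF mZ] by (auto simp: class_DL2_def)
qed

lemma GTAI_left_weighted:
  fixes X Y \<Theta> \<Delta> :: "nat \<Rightarrow> 'a \<Rightarrow> real"
  assumes X: "\<And>k. k \<in> {1..n} \<Longrightarrow> nonneg_rv (X k)"
    and \<Theta>: "\<And>k. k \<in> {1..n} \<Longrightarrow> weight_between (\<xi> k) (\<delta> k) (\<Theta> k)"
    and Y: "\<And>l. l \<in> {1..m} \<Longrightarrow> nonneg_rv (Y l)"
    and \<Delta>: "\<And>l. l \<in> {1..m} \<Longrightarrow> weight_between (\<gamma> l) (\<zeta> l) (\<Delta> l)"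
    and D: "\<And>k l. k \<in> {1..n} \<Longrightarrow> l \<in> {1..m} \<Longrightarrow> scaling_bounded (joint_tail M (X k) (Y l))"
    and G: "GTAI_left M n X m Y"
  shows "GTAI_left M n (\<lambda>k \<omega>. \<Theta> k \<omega> * X k \<omega>) m (\<lambda>l \<omega>. \<Delta> l \<omega> * Y l \<omega>)"
  unfolding GTAI_left_def
proof (intro ballI impI conjI allI)
  let ?Z = "\<lambda>k \<omega>. \<Theta> k \<omega> * X k \<omega>" and ?W = "\<lambda>l \<omega>. \<Delta> l \<omega> * Y l \<omega>"
  fix i k j assume ikj: "i \<in> {1..n}" "k \<in> {1..n}" "j \<in> {1..m}" "i \<noteq> k"
  note bounds = weighted_joint_tail_bounds[OF X[OF ikj(2)] \<Theta>[OF ikj(2)] Y[OF ikj(3)] \<Delta>[OF ikj(3)]]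
  have pos: "0 < \<xi> k" "0 < \<delta> k" "0 < \<delta> i" "0 < \<gamma> j" "0 < \<zeta> j"
    using \<Theta>[OF ikj(1)] \<Theta>[OF ikj(2)] \<Delta>[OF ikj(3)] by (auto simp: weight_between_def)
  have jp: "\<forall>x\<ge>0. \<forall>y\<ge>0. joint_tail M (X k) (Y j) x y > 0"
    and negl: "tail_negligible (\<lambda>u x y. \<P>(\<omega> in M. \<bar>X i \<omega>\<bar> > u \<and> X k \<omega> > x \<and> Y j \<omega> > y))
      (joint_tail M (X k) (Y j))"
    using G ikj unfolding GTAI_left_def by blast+
  {
    fix x y :: real assume "x \<ge> 0" "y \<ge> 0"
    then have "0 < joint_tail M (X k) (Y j) (x / \<xi> k) (y / \<gamma> j)" using jp pos by simp
    also have "\<dots> \<le> joint_tail M (?Z k) (?W j) x y" by (rule bounds)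
    finally show "0 < joint_tail M (?Z k) (?W j) x y" .
  }
  have [measurable]: "X i \<in> borel_measurable M" "X k \<in> borel_measurable M" "Y j \<in> borel_measurable M"
    using X Y ikj by (auto simp: nonneg_rv_def)
  have le: "\<P>(\<omega> in M. \<bar>?Z i \<omega>\<bar> > u \<and> ?Z k \<omega> > x \<and> ?W j \<omega> > y)
      \<le> \<P>(\<omega> in M. \<bar>X i \<omega>\<bar> > u / \<delta> i \<and> X k \<omega> > x / \<delta> k \<and> Y j \<omega> > y / \<zeta> j)" for u x y
  proof (rule finite_measure_mono_AE)
    show "AE \<omega> in M. \<omega> \<in> {\<omega> \<in> space M. \<bar>?Z i \<omega>\<bar> > u \<and> ?Z k \<omega> > x \<and> ?W j \<omega> > y} \<longrightarrow>
        \<omega> \<in> {\<omega> \<in> space M. \<bar>X i \<omega>\<bar> > u / \<delta> i \<and> X k \<omega> > x / \<delta> k \<and> Y j \<omega> > y / \<zeta> j}"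
      using weighted_threshold[OF X[OF ikj(1)] \<Theta>[OF ikj(1)]] weighted_threshold[OF X[OF ikj(2)] \<Theta>[OF ikj(2)]]
        weighted_threshold[OF Y[OF ikj(3)] \<Delta>[OF ikj(3)]]
      by eventually_elim auto
  qed measurable
  show "tail_negligible (\<lambda>u x y. \<P>(\<omega> in M. \<bar>?Z i \<omega>\<bar> > u \<and> ?Z k \<omega> > x \<and> ?W j \<omega> > y))
      (joint_tail M (?Z k) (?W j))"
    by (rule tail_negligible_mono[OF tail_negligible_rescale[OF negl D[OF ikj(2,3)] pos(3,2,5,1,4)] le])
      (rule bounds)
qed

section \<open>Sums and maxima of asymptotically independent tails\<close>

text \<open>
  The largest term is at least the average, hence exceeds \<open>x / card I\<close>. If it is at
  most \<open>x - a\<close>, the other terms add up to more than \<open>a\<close>, and one of them exceeds \<open>a / card I\<close>.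
\<close>
lemma sum_exceeds_cases:
  fixes z :: "'i \<Rightarrow> real"
  assumes I: "finite I" "I \<noteq> {}" and sum: "x < (\<Sum>i\<in>I. z i)" and a: "a \<ge> 0"
  shows "\<exists>k\<in>I. x / card I < z k"
    and "(\<exists>k\<in>I. x - a < z k) \<or> (\<exists>k\<in>I. \<exists>i\<in>I - {k}. x / card I < z k \<and> a / card I < z i)"
proof -
  have card: "real (card I) > 0" using I by (simp add: card_gt_0_iff)
  show "\<exists>k\<in>I. x / card I < z k"
  proof (rule ccontr)
    assume "\<not> (\<exists>k\<in>I. x / card I < z k)"
    then have "(\<Sum>i\<in>I. z i) \<le> (\<Sum>i\<in>I. x / card I)" by (intro sum_mono) (auto simp: not_less)
    also have "\<dots> = x" using card by simp
    finally show False using sum by simp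
  qed
  then obtain k where k: "k \<in> I" "x / card I < z k" by blast
  show "(\<exists>k\<in>I. x - a < z k) \<or> (\<exists>k\<in>I. \<exists>i\<in>I - {k}. x / card I < z k \<and> a / card I < z i)"
  proof (rule ccontr)
    assume neg: "\<not> ?thesis"
    then have small: "z i \<le> a / card I" if "i \<in> I - {k}" for i
      using that k by (auto simp: not_less)
    have "z k \<le> x - a" using neg k(1) by (auto simp: not_less)
    moreover have "(\<Sum>i\<in>I - {k}. z i) \<le> (\<Sum>i\<in>I - {k}. a / card I)"
      using small by (intro sum_mono)
    moreover have "(\<Sum>i\<in>I - {k}. a / card I) \<le> (\<Sum>i\<in>I. a / card I)"
      using I a by (intro sum_mono2) auto
    moreover have "(\<Sum>i\<in>I. a / card I) = a" using card by simp
    moreover have "(\<Sum>i\<in>I. z i) = z k + (\<Sum>i\<in>I - {k}. z i)" using I k(1) by (simp add: sum.remove)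
    ultimately show False using sum by linarith
  qed
qed

text \<open>
  Removing from each event its intersections with the others leaves disjoint events, and each
  of them has lost at most the fraction \<open>card I * \<epsilon>\<close> of its probability.
\<close>
lemma prob_Union_ge_of_small_overlaps:
  fixes \<epsilon> :: real
  assumes I: "finite I" and A: "\<And>i. i \<in> I \<Longrightarrow> A i \<in> events"
    and overlap: "\<And>i j. i \<in> I \<Longrightarrow> j \<in> I \<Longrightarrow> i \<noteq> j \<Longrightarrow> prob (A i \<inter> A j) \<le> \<epsilon> * prob (A i)"
    and \<epsilon>: "\<epsilon> \<ge> 0"
  shows "(1 - card I * \<epsilon>) * (\<Sum>i\<in>I. prob (A i)) \<le> prob (\<Union>i\<in>I. A i)"
proof -
  define B where "B i = A i - (\<Union>j\<in>I - {i}. A i \<inter> A j)" for i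
  have B: "B i \<in> events" if "i \<in> I" for i
    unfolding B_def using that I A by (intro sets.Diff sets.finite_UN sets.Int) auto
  have "(1 - card I * \<epsilon>) * prob (A i) \<le> prob (B i)" if i: "i \<in> I" for i
  proof -
    have "prob (\<Union>j\<in>I - {i}. A i \<inter> A j) \<le> (\<Sum>j\<in>I - {i}. prob (A i \<inter> A j))"
      using I A i by (intro measure_UNION_le) auto
    also have "\<dots> \<le> (\<Sum>j\<in>I - {i}. \<epsilon> * prob (A i))"
      using i by (intro sum_mono overlap) auto
    also have "\<dots> \<le> (\<Sum>j\<in>I. \<epsilon> * prob (A i))"
      using I \<epsilon> by (intro sum_mono2) auto
    also have "\<dots> = card I * \<epsilon> * prob (A i)" by simp
    finally have "prob (\<Union>j\<in>I - {i}. A i \<inter> A j) \<le> card I * \<epsilon> * prob (A i)" .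
    moreover have "prob (B i) = prob (A i) - prob (\<Union>j\<in>I - {i}. A i \<inter> A j)"
      unfolding B_def using I A i by (intro finite_measure_Diff sets.finite_UN) auto
    ultimately show ?thesis by (simp add: algebra_simps)
  qed
  then have "(1 - card I * \<epsilon>) * (\<Sum>i\<in>I. prob (A i)) \<le> (\<Sum>i\<in>I. prob (B i))"
    unfolding sum_distrib_left by (rule sum_mono)
  also have "\<dots> = prob (\<Union>i\<in>I. B i)"
    using I B by (intro finite_measure_finite_Union[symmetric])
      (auto simp: disjoint_family_on_def B_def)
  also have "\<dots> \<le> prob (\<Union>i\<in>I. A i)"
    using I A by (intro finite_measure_mono sets.finite_UN) (auto simp: B_def)
  finally show ?thesis .
qed

end

text \<open>
  The asymptotic equivalences concern only the joint law of the two families, so they are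
  derived without reference to weights and are applied to the products at the end.
\<close>
locale asymptotically_independent_tails = prob_space +
  fixes n m :: nat and Z W :: "nat \<Rightarrow> 'a \<Rightarrow> real"
  assumes n: "n \<ge> 1" and m: "m \<ge> 1"
    and nonneg: "k \<in> {1..n} \<Longrightarrow> nonneg_rv (Z k)" "l \<in> {1..m} \<Longrightarrow> nonneg_rv (W l)"
    and DL2: "k \<in> {1..n} \<Longrightarrow> l \<in> {1..m} \<Longrightarrow> (Z k, W l) \<in> class_DL2 M"
    and GTAI: "GTAI M n Z m W"
begin

lemma measurable_Z [measurable]: "k \<in> {1..n} \<Longrightarrow> Z k \<in> borel_measurable M"
  and measurable_W [measurable]: "l \<in> {1..m} \<Longrightarrow> W l \<in> borel_measurable M"
  using nonneg by (auto simp: nonneg_rv_def)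

lemma AE_nonneg: "AE \<omega> in M. (\<forall>k\<in>{1..n}. 0 \<le> Z k \<omega>) \<and> (\<forall>l\<in>{1..m}. 0 \<le> W l \<omega>)"
  using nonneg by (intro AE_conjI AE_finite_allI) (auto simp: nonneg_rv_def)

definition pair_tail :: "nat \<times> nat \<Rightarrow> real \<Rightarrow> real \<Rightarrow> real" where
  "pair_tail p = joint_tail M (Z (fst p)) (W (snd p))"

definition pairs :: "(nat \<times> nat) set" where
  "pairs = {1..n} \<times> {1..m}"

definition both_exceed :: "nat \<times> nat \<Rightarrow> real \<Rightarrow> real \<Rightarrow> 'a set" where
  "both_exceed p x y = {\<omega> \<in> space M. Z (fst p) \<omega> > x \<and> W (snd p) \<omega> > y}"

lemma both_exceed_sets [measurable]: "p \<in> pairs \<Longrightarrow> both_exceed p x y \<in> events"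
proof -
  assume "p \<in> pairs"
  then have [measurable]: "Z (fst p) \<in> borel_measurable M" "W (snd p) \<in> borel_measurable M"
    by (auto simp: pairs_def)
  show ?thesis unfolding both_exceed_def by measurable
qed

lemma prob_both_exceed: "prob (both_exceed p x y) = pair_tail p x y"
  by (simp add: both_exceed_def pair_tail_def joint_tail_def)

lemma finite_pairs: "finite pairs" and pairs_nonempty: "pairs \<noteq> {}"
  using n m by (auto simp: pairs_def)

lemma pair_tail_pos: "p \<in> pairs \<Longrightarrow> x \<ge> 0 \<Longrightarrow> y \<ge> 0 \<Longrightarrow> 0 < pair_tail p x y"
  and pair_tail_shift: "p \<in> pairs \<Longrightarrow> shift_insensitive (pair_tail p)"
  and pair_tail_scaling: "p \<in> pairs \<Longrightarrow> scaling_bounded (pair_tail p)"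
  using DL2[of "fst p" "snd p"] class_D2_iff[of "Z (fst p)" "W (snd p)"]
    class_L2_iff[of "Z (fst p)" "W (snd p)"]
  by (auto simp: pair_tail_def pairs_def class_DL2_def)

definition extra_Z :: "nat \<Rightarrow> nat \<times> nat \<Rightarrow> real \<Rightarrow> real \<Rightarrow> real \<Rightarrow> 'a set" where
  "extra_Z i p u x y = {\<omega> \<in> space M. \<bar>Z i \<omega>\<bar> > u \<and> Z (fst p) \<omega> > x \<and> W (snd p) \<omega> > y}"

definition extra_W :: "nat \<Rightarrow> nat \<times> nat \<Rightarrow> real \<Rightarrow> real \<Rightarrow> real \<Rightarrow> 'a set" where
  "extra_W j p u x y = {\<omega> \<in> space M. \<bar>W j \<omega>\<bar> > u \<and> Z (fst p) \<omega> > x \<and> W (snd p) \<omega> > y}"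

lemma extra_sets [measurable]:
  "p \<in> pairs \<Longrightarrow> i \<in> {1..n} \<Longrightarrow> extra_Z i p u x y \<in> events"
  "p \<in> pairs \<Longrightarrow> j \<in> {1..m} \<Longrightarrow> extra_W j p u x y \<in> events"
proof -
  assume "p \<in> pairs"
  then have [measurable]: "Z (fst p) \<in> borel_measurable M" "W (snd p) \<in> borel_measurable M"
    by (auto simp: pairs_def)
  show "extra_Z i p u x y \<in> events" if "i \<in> {1..n}"
    using that unfolding extra_Z_def by measurable
  show "extra_W j p u x y \<in> events" if "j \<in> {1..m}"
    using that unfolding extra_W_def by measurable
qed

text \<open>
  The first half of GTAI controls a further large variable among the \<open>Z\<close>, the second half one
  among the \<open>W\<close>.
\<close>
lemma extra_negligible:
  shows "p \<in> pairs \<Longrightarrow> i \<in> {1..n} - {fst p} \<Longrightarrow> tail_negligible (\<lambda>u x y. prob (extra_Z i p u x y)) (pair_tail p)"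
    and "p \<in> pairs \<Longrightarrow> j \<in> {1..m} - {snd p} \<Longrightarrow> tail_negligible (\<lambda>u x y. prob (extra_W j p u x y)) (pair_tail p)"
proof -
  have G: "GTAI_left M n Z m W" "GTAI_left M m W n Z"
    using GTAI GTAI_iff_GTAI_left by auto
  show "tail_negligible (\<lambda>u x y. prob (extra_Z i p u x y)) (pair_tail p)"
    if "p \<in> pairs" "i \<in> {1..n} - {fst p}"
    using that G(1) unfolding GTAI_left_def extra_Z_def pair_tail_def pairs_def by auto
  assume p: "p \<in> pairs" "j \<in> {1..m} - {snd p}"
  then have "tail_negligible (\<lambda>u y x. \<P>(\<omega> in M. \<bar>W j \<omega>\<bar> > u \<and> W (snd p) \<omega> > y \<and> Z (fst p) \<omega> > x))
      (joint_tail M (W (snd p)) (Z (fst p)))"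
    using G(2) unfolding GTAI_left_def pairs_def by auto
  moreover have "\<P>(\<omega> in M. \<bar>W j \<omega>\<bar> > u \<and> W (snd p) \<omega> > y \<and> Z (fst p) \<omega> > x) = prob (extra_W j p u x y)"
    for u x y unfolding extra_W_def by (rule arg_cong[where f = prob]) auto
  moreover have "joint_tail M (W (snd p)) (Z (fst p)) = (\<lambda>y x. pair_tail p x y)"
    by (intro ext) (simp add: pair_tail_def joint_tail_swap[of "W (snd p)"])
  ultimately have *: "tail_negligible (\<lambda>u y x. prob (extra_W j p u x y)) (\<lambda>y x. pair_tail p x y)"
    by simp
  show "tail_negligible (\<lambda>u x y. prob (extra_W j p u x y)) (pair_tail p)"
    unfolding tail_negligible_def
  proof (intro allI impI)
    fix \<epsilon> :: real assume "\<epsilon> > 0"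
    from tail_negligibleD[OF * this] obtain N where
      "\<forall>u\<ge>N. \<forall>y\<ge>N. \<forall>x\<ge>N. prob (extra_W j p u x y) \<le> \<epsilon> * pair_tail p x y" ..
    then show "\<exists>N. \<forall>u\<ge>N. \<forall>x\<ge>N. \<forall>y\<ge>N. prob (extra_W j p u x y) \<le> \<epsilon> * pair_tail p x y"
      by (intro exI[of _ N]) simp
  qed
qed

definition tail_sum :: "real \<times> real \<Rightarrow> real" where
  "tail_sum q = (\<Sum>p\<in>pairs. pair_tail p (fst q) (snd q))"

lemma tail_sum_pos: "\<forall>\<^sub>F q in at_top \<times>\<^sub>F at_top. 0 < tail_sum q"
  unfolding eventually_at_top2 tail_sum_def
  by (rule exI[of _ 0]) (auto intro!: sum_pos pair_tail_pos finite_pairs pairs_nonempty)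

text \<open>
  Two different pairs of indices differ in the first or in the second component. On the
  intersection of their events, a third variable therefore exceeds the level \<open>x\<close> or \<open>y\<close>.
\<close>
lemma max_lower:
  assumes "\<epsilon> > 0"
  shows "\<forall>\<^sub>F q in at_top \<times>\<^sub>F at_top. (1 - \<epsilon>) * tail_sum q \<le> prob (\<Union>p\<in>pairs. both_exceed p (fst q) (snd q))"
proof -
  define \<eta> where "\<eta> = \<epsilon> / card pairs"
  have card: "real (card pairs) > 0" using finite_pairs pairs_nonempty by (simp add: card_gt_0_iff)
  have \<eta>: "\<eta> > 0" using assms card by (simp add: \<eta>_def)
  have "\<forall>\<^sub>F q in at_top \<times>\<^sub>F at_top.
      prob (both_exceed p (fst q) (snd q) \<inter> both_exceed p' (fst q) (snd q)) \<le> \<eta> * pair_tail p (fst q) (snd q)"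
    if p: "p \<in> pairs" "p' \<in> pairs" "p \<noteq> p'" for p p'
  proof (cases "fst p' = fst p")
    case False
    with p have i: "fst p' \<in> {1..n} - {fst p}" by (auto simp: pairs_def)
    from tail_negligibleD[OF extra_negligible(1)[OF p(1) i] \<eta>] obtain N where
      N: "\<forall>u\<ge>N. \<forall>x\<ge>N. \<forall>y\<ge>N. prob (extra_Z (fst p') p u x y) \<le> \<eta> * pair_tail p x y" by blast
    have "prob (both_exceed p x y \<inter> both_exceed p' x y) \<le> \<eta> * pair_tail p x y" if "x \<ge> N" "y \<ge> N" for x y
    proof -
      have "prob (both_exceed p x y \<inter> both_exceed p' x y) \<le> prob (extra_Z (fst p') p x x y)"
        using p i by (intro finite_measure_mono extra_sets) (auto simp: both_exceed_def extra_Z_def)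
      then show ?thesis using N that by force
    qed
    then show ?thesis unfolding eventually_at_top2 by auto
  next
    case True
    with p have i: "snd p' \<in> {1..m} - {snd p}" by (auto simp: pairs_def prod_eq_iff)
    from tail_negligibleD[OF extra_negligible(2)[OF p(1) i] \<eta>] obtain N where
      N: "\<forall>u\<ge>N. \<forall>x\<ge>N. \<forall>y\<ge>N. prob (extra_W (snd p') p u x y) \<le> \<eta> * pair_tail p x y" by blast
    have "prob (both_exceed p x y \<inter> both_exceed p' x y) \<le> \<eta> * pair_tail p x y" if "x \<ge> N" "y \<ge> N" for x y
    proof -
      have "prob (both_exceed p x y \<inter> both_exceed p' x y) \<le> prob (extra_W (snd p') p y x y)"
        using p i by (intro finite_measure_mono extra_sets) (auto simp: both_exceed_def extra_W_def)
      then show ?thesis using N that by force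
    qed
    then show ?thesis unfolding eventually_at_top2 by auto
  qed
  then have "\<forall>\<^sub>F q in at_top \<times>\<^sub>F at_top. \<forall>p\<in>pairs. \<forall>p'\<in>pairs - {p}.
      prob (both_exceed p (fst q) (snd q) \<inter> both_exceed p' (fst q) (snd q)) \<le> \<eta> * pair_tail p (fst q) (snd q)"
    by (intro eventually_ball_finite ballI finite_pairs finite_Diff) auto
  then show ?thesis
  proof eventually_elim
    case (elim q)
    have "(1 - card pairs * \<eta>) * (\<Sum>p\<in>pairs. prob (both_exceed p (fst q) (snd q)))
        \<le> prob (\<Union>p\<in>pairs. both_exceed p (fst q) (snd q))"
      using elim \<eta> by (intro prob_Union_ge_of_small_overlaps finite_pairs both_exceed_sets)
        (auto simp: prob_both_exceed)
    then show ?case using card by (simp add: \<eta>_def tail_sum_def prob_both_exceed)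
  qed
qed

lemma max_upper: "prob (\<Union>p\<in>pairs. both_exceed p (fst q) (snd q)) \<le> tail_sum q"
  unfolding tail_sum_def prob_both_exceed[symmetric]
  by (intro measure_UNION_le finite_pairs both_exceed_sets)

lemma max_asymp_equiv: "(\<lambda>q. prob (\<Union>p\<in>pairs. both_exceed p (fst q) (snd q))) \<sim>[at_top \<times>\<^sub>F at_top] tail_sum"
proof (rule asymp_equiv_if_close[OF tail_sum_pos max_lower])
  fix \<epsilon> :: real assume "\<epsilon> > 0"
  show "\<forall>\<^sub>F q in at_top \<times>\<^sub>F at_top. prob (\<Union>p\<in>pairs. both_exceed p (fst q) (snd q)) \<le> (1 + \<epsilon>) * tail_sum q"
    using tail_sum_pos
  proof eventually_elim
    case (elim q)
    have "tail_sum q \<le> (1 + \<epsilon>) * tail_sum q" using elim \<open>\<epsilon> > 0\<close> by (simp add: algebra_simps)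
    with max_upper[of q] show ?case by linarith
  qed
qed

definition sums_exceed :: "real \<Rightarrow> real \<Rightarrow> 'a set" where
  "sums_exceed x y = {\<omega> \<in> space M. (\<Sum>k=1..n. Z k \<omega>) > x \<and> (\<Sum>l=1..m. W l \<omega>) > y}"

lemma sums_exceed_sets [measurable]: "sums_exceed x y \<in> events"
  unfolding sums_exceed_def by measurable

lemma max_le_sums: "prob (\<Union>p\<in>pairs. both_exceed p x y) \<le> prob (sums_exceed x y)"
proof (rule finite_measure_mono_AE)
  show "AE \<omega> in M. \<omega> \<in> (\<Union>p\<in>pairs. both_exceed p x y) \<longrightarrow> \<omega> \<in> sums_exceed x y"
    using AE_nonneg
  proof eventually_elim
    case (elim \<omega>)
    have "Z k \<omega> \<le> (\<Sum>k=1..n. Z k \<omega>)" if "k \<in> {1..n}" for k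
      using elim that by (intro member_le_sum) auto
    moreover have "W l \<omega> \<le> (\<Sum>l=1..m. W l \<omega>)" if "l \<in> {1..m}" for l
      using elim that by (intro member_le_sum) auto
    ultimately show ?case
      by (force simp: both_exceed_def sums_exceed_def pairs_def)
  qed
qed measurable

text \<open>
  The part of the event of large sums that is charged to the pair \<open>p\<close>: either its
  variables exceed the levels lowered by \<open>a\<close>, or they exceed the fractions \<open>x / n\<close> and \<open>y / m\<close> while
  a further variable is large.
\<close>
definition excess_cover :: "real \<Rightarrow> real \<Rightarrow> real \<Rightarrow> nat \<times> nat \<Rightarrow> 'a set" where
  "excess_cover a x y p = both_exceed p (x - a) (y - a) \<union>
     (\<Union>i\<in>{1..n} - {fst p}. extra_Z i p (a / n) (x / n) (y / m)) \<union>
     (\<Union>j\<in>{1..m} - {snd p}. extra_W j p (a / m) (x / n) (y / m))"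

lemma excess_cover_sets: "p \<in> pairs \<Longrightarrow> excess_cover a x y p \<in> events"
  unfolding excess_cover_def by (intro sets.Un sets.finite_UN) auto

lemma sums_exceed_subset:
  assumes a: "a \<ge> 0"
  shows "sums_exceed x y \<subseteq> (\<Union>p\<in>pairs. excess_cover a x y p)"
proof
  fix \<omega> assume \<omega>: "\<omega> \<in> sums_exceed x y"
  then have sp: "\<omega> \<in> space M" and sums: "x < (\<Sum>k=1..n. Z k \<omega>)" "y < (\<Sum>l=1..m. W l \<omega>)"
    by (auto simp: sums_exceed_def)
  have ne: "{1..n} \<noteq> {}" "{1..m} \<noteq> {}" using n m by auto
  note splitZ = sum_exceeds_cases[OF finite_atLeastAtMost ne(1) sums(1) a, unfolded card_atLeastAtMost diff_Suc_1]
  note splitW = sum_exceeds_cases[OF finite_atLeastAtMost ne(2) sums(2) a, unfolded card_atLeastAtMost diff_Suc_1]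
  have in_cover: "\<omega> \<in> (\<Union>p\<in>pairs. excess_cover a x y p)"
    if "k \<in> {1..n}" "l \<in> {1..m}" "\<omega> \<in> excess_cover a x y (k, l)" for k l
    using that unfolding pairs_def by blast
  obtain k0 where k0: "k0 \<in> {1..n}" "x / n < Z k0 \<omega>" using splitZ(1) by blast
  obtain l0 where l0: "l0 \<in> {1..m}" "y / m < W l0 \<omega>" using splitW(1) by blast
  from splitZ(2) show "\<omega> \<in> (\<Union>p\<in>pairs. excess_cover a x y p)"
  proof (elim disjE bexE conjE)
    fix k assume k: "k \<in> {1..n}" "x - a < Z k \<omega>"
    from splitW(2) show ?thesis
    proof (elim disjE bexE conjE)
      fix l assume l: "l \<in> {1..m}" "y - a < W l \<omega>"
      have "\<omega> \<in> both_exceed (k, l) (x - a) (y - a)" using sp k l by (simp add: both_exceed_def)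
      then show ?thesis by (intro in_cover[OF k(1) l(1)]) (simp add: excess_cover_def)
    next
      fix l j assume l: "l \<in> {1..m}" "j \<in> {1..m} - {l}" "y / m < W l \<omega>" "a / m < W j \<omega>"
      have "\<omega> \<in> extra_W j (k0, l) (a / m) (x / n) (y / m)" using sp k0 l by (simp add: extra_W_def)
      then show ?thesis using l(2) by (intro in_cover[OF k0(1) l(1)]) (auto simp: excess_cover_def)
    qed
  next
    fix k i assume k: "k \<in> {1..n}" "i \<in> {1..n} - {k}" "x / n < Z k \<omega>" "a / n < Z i \<omega>"
    have "\<omega> \<in> extra_Z i (k, l0) (a / n) (x / n) (y / m)" using sp l0 k by (simp add: extra_Z_def)
    then show ?thesis using k(2) by (intro in_cover[OF k(1) l0(1)]) (auto simp: excess_cover_def)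
  qed
qed

text \<open>
  The quantifiers are nested, and not joint in \<open>a\<close> and \<open>(x, y)\<close>: the shift \<open>a\<close> is fixed first, so
  that long-tailedness can be applied to it.
\<close>
lemma extra_rescaled:
  assumes p: "p \<in> pairs" and \<eta>: "\<eta> > 0"
  shows "i \<in> {1..n} - {fst p} \<Longrightarrow> \<forall>\<^sub>F a in at_top. \<forall>\<^sub>F q in at_top \<times>\<^sub>F at_top.
      prob (extra_Z i p (a / n) (fst q / n) (snd q / m)) \<le> \<eta> * pair_tail p (fst q) (snd q)"
    and "j \<in> {1..m} - {snd p} \<Longrightarrow> \<forall>\<^sub>F a in at_top. \<forall>\<^sub>F q in at_top \<times>\<^sub>F at_top.
      prob (extra_W j p (a / m) (fst q / n) (snd q / m)) \<le> \<eta> * pair_tail p (fst q) (snd q)"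
proof -
  have pos: "0 < real n" "0 < real m" using n m by auto
  have *: "\<forall>\<^sub>F a in at_top. \<forall>\<^sub>F q in at_top \<times>\<^sub>F at_top. h (a / r) (fst q / n) (snd q / m) \<le> \<eta> * pair_tail p (fst q) (snd q)"
    if h: "tail_negligible h (pair_tail p)" and r: "r > 0" for h and r :: real
  proof -
    \<comment> \<open>The factors \<open>1\<close> compare the tail at \<open>(x / n, y / m)\<close> with the one at \<open>(x, y)\<close> itself.\<close>
    from tail_negligibleD[OF tail_negligible_rescale[OF h pair_tail_scaling[OF p] r pos zero_less_one zero_less_one] \<eta>]
    obtain N where N: "\<forall>u\<ge>N. \<forall>x\<ge>N. \<forall>y\<ge>N. h (u / r) (x / n) (y / m) \<le> \<eta> * pair_tail p (x / 1) (y / 1)"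
      by blast
    have "\<forall>\<^sub>F q in at_top \<times>\<^sub>F at_top. h (a / r) (fst q / n) (snd q / m) \<le> \<eta> * pair_tail p (fst q) (snd q)"
      if "a \<ge> N" for a
      using N that unfolding eventually_at_top2 by auto
    then show ?thesis unfolding eventually_at_top_linorder by blast
  qed
  show "i \<in> {1..n} - {fst p} \<Longrightarrow> \<forall>\<^sub>F a in at_top. \<forall>\<^sub>F q in at_top \<times>\<^sub>F at_top.
      prob (extra_Z i p (a / n) (fst q / n) (snd q / m)) \<le> \<eta> * pair_tail p (fst q) (snd q)"
    by (rule *[OF extra_negligible(1)[OF p] pos(1)])
  show "j \<in> {1..m} - {snd p} \<Longrightarrow> \<forall>\<^sub>F a in at_top. \<forall>\<^sub>F q in at_top \<times>\<^sub>F at_top.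
      prob (extra_W j p (a / m) (fst q / n) (snd q / m)) \<le> \<eta> * pair_tail p (fst q) (snd q)"
    by (rule *[OF extra_negligible(2)[OF p] pos(2)])
qed

text \<open>
  At most \<open>n + m\<close> events with a further large variable and the error of the shift share
  \<open>\<epsilon>\<close>; this is the origin of the denominator \<open>n + m + 1\<close> in the proof.
\<close>
lemma excess_cover_bound:
  assumes p: "p \<in> pairs" and \<epsilon>: "\<epsilon> > 0"
  shows "\<forall>\<^sub>F a in at_top. \<forall>\<^sub>F q in at_top \<times>\<^sub>F at_top.
    prob (excess_cover a (fst q) (snd q) p) \<le> (1 + \<epsilon>) * pair_tail p (fst q) (snd q)"
proof -
  define \<eta> where "\<eta> = \<epsilon> / (n + m + 1)"
  have \<eta>: "\<eta> > 0" using \<epsilon> by (simp add: \<eta>_def)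
  have "\<forall>\<^sub>F a in at_top. \<forall>i\<in>{1..n} - {fst p}. \<forall>\<^sub>F q in at_top \<times>\<^sub>F at_top.
      prob (extra_Z i p (a / n) (fst q / n) (snd q / m)) \<le> \<eta> * pair_tail p (fst q) (snd q)"
    by (intro eventually_ball_finite ballI extra_rescaled p \<eta>) auto
  moreover have "\<forall>\<^sub>F a in at_top. \<forall>j\<in>{1..m} - {snd p}. \<forall>\<^sub>F q in at_top \<times>\<^sub>F at_top.
      prob (extra_W j p (a / m) (fst q / n) (snd q / m)) \<le> \<eta> * pair_tail p (fst q) (snd q)"
    by (intro eventually_ball_finite ballI extra_rescaled p \<eta>) auto
  ultimately show ?thesis
    using eventually_ge_at_top[of 0]
  proof eventually_elim
    case (elim a)
    have "\<forall>\<^sub>F q in at_top \<times>\<^sub>F at_top. pair_tail p (fst q - a) (snd q - a) \<le> (1 + \<eta>) * pair_tail p (fst q) (snd q)"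
      using pair_tail_shift[OF p] elim(3) \<eta> unfolding shift_insensitive_def case_prod_unfold by blast
    moreover have "\<forall>\<^sub>F q in at_top \<times>\<^sub>F at_top. \<forall>i\<in>{1..n} - {fst p}.
        prob (extra_Z i p (a / n) (fst q / n) (snd q / m)) \<le> \<eta> * pair_tail p (fst q) (snd q)"
      using elim(1) by (intro eventually_ball_finite) auto
    moreover have "\<forall>\<^sub>F q in at_top \<times>\<^sub>F at_top. \<forall>j\<in>{1..m} - {snd p}.
        prob (extra_W j p (a / m) (fst q / n) (snd q / m)) \<le> \<eta> * pair_tail p (fst q) (snd q)"
      using elim(2) by (intro eventually_ball_finite) auto
    ultimately show ?case
    proof eventually_elim
      case (elim q)
      let ?x = "fst q" and ?y = "snd q"
      let ?EZ = "\<lambda>i. extra_Z i p (a / n) (?x / n) (?y / m)" and ?EW = "\<lambda>j. extra_W j p (a / m) (?x / n) (?y / m)"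
      have pt0: "0 \<le> pair_tail p ?x ?y" by (simp add: pair_tail_def joint_tail_def)
      have sets: "both_exceed p (?x - a) (?y - a) \<in> events" "(\<Union>i\<in>{1..n} - {fst p}. ?EZ i) \<in> events"
        "(\<Union>j\<in>{1..m} - {snd p}. ?EW j) \<in> events"
        using p by (auto intro!: sets.finite_UN)
      have "prob (\<Union>i\<in>{1..n} - {fst p}. ?EZ i) \<le> (\<Sum>i\<in>{1..n} - {fst p}. prob (?EZ i))"
        using p by (intro measure_UNION_le) auto
      also have "\<dots> \<le> (\<Sum>i\<in>{1..n} - {fst p}. \<eta> * pair_tail p ?x ?y)"
        using elim(2) by (intro sum_mono) auto
      also have "\<dots> \<le> (\<Sum>i\<in>{1..n}. \<eta> * pair_tail p ?x ?y)"
        using \<eta> pt0 by (intro sum_mono2) auto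
      finally have Z: "prob (\<Union>i\<in>{1..n} - {fst p}. ?EZ i) \<le> n * \<eta> * pair_tail p ?x ?y" by simp
      have "prob (\<Union>j\<in>{1..m} - {snd p}. ?EW j) \<le> (\<Sum>j\<in>{1..m} - {snd p}. prob (?EW j))"
        using p by (intro measure_UNION_le) auto
      also have "\<dots> \<le> (\<Sum>j\<in>{1..m} - {snd p}. \<eta> * pair_tail p ?x ?y)"
        using elim(3) by (intro sum_mono) auto
      also have "\<dots> \<le> (\<Sum>j\<in>{1..m}. \<eta> * pair_tail p ?x ?y)"
        using \<eta> pt0 by (intro sum_mono2) auto
      finally have W: "prob (\<Union>j\<in>{1..m} - {snd p}. ?EW j) \<le> m * \<eta> * pair_tail p ?x ?y" by simp
      have "prob (excess_cover a ?x ?y p) \<le> pair_tail p (?x - a) (?y - a) +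
          prob (\<Union>i\<in>{1..n} - {fst p}. ?EZ i) + prob (\<Union>j\<in>{1..m} - {snd p}. ?EW j)"
        unfolding excess_cover_def prob_both_exceed[symmetric]
        using sets by (intro order.trans[OF measure_Un_le] add_mono measure_Un_le sets.Un order.refl) auto
      also have "\<dots> \<le> (1 + \<eta>) * pair_tail p ?x ?y + n * \<eta> * pair_tail p ?x ?y + m * \<eta> * pair_tail p ?x ?y"
        using elim(1) Z W by (intro add_mono)
      also have "\<dots> = (1 + (n + m + 1) * \<eta>) * pair_tail p ?x ?y" by (simp add: algebra_simps)
      also have "(n + m + 1) * \<eta> = \<epsilon>" by (simp add: \<eta>_def)
      finally show ?case .
    qed
  qed
qed

lemma sums_upper:
  assumes \<epsilon>: "\<epsilon> > 0"
  shows "\<forall>\<^sub>F q in at_top \<times>\<^sub>F at_top. prob (sums_exceed (fst q) (snd q)) \<le> (1 + \<epsilon>) * tail_sum q"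
proof -
  have "\<forall>\<^sub>F a in at_top. (0 :: real) \<le> a \<and> (\<forall>p\<in>pairs. \<forall>\<^sub>F q in at_top \<times>\<^sub>F at_top.
      prob (excess_cover a (fst q) (snd q) p) \<le> (1 + \<epsilon>) * pair_tail p (fst q) (snd q))"
    by (intro eventually_conj eventually_ge_at_top eventually_ball_finite finite_pairs ballI excess_cover_bound \<epsilon>)
  then obtain a :: real where a: "0 \<le> a" and "\<forall>p\<in>pairs. \<forall>\<^sub>F q in at_top \<times>\<^sub>F at_top.
      prob (excess_cover a (fst q) (snd q) p) \<le> (1 + \<epsilon>) * pair_tail p (fst q) (snd q)"
    using eventually_happens'[OF trivial_limit_at_top_linorder] by blast
  then have "\<forall>\<^sub>F q in at_top \<times>\<^sub>F at_top. \<forall>p\<in>pairs.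
      prob (excess_cover a (fst q) (snd q) p) \<le> (1 + \<epsilon>) * pair_tail p (fst q) (snd q)"
    by (intro eventually_ball_finite finite_pairs)
  then show ?thesis
  proof eventually_elim
    case (elim q)
    have "prob (sums_exceed (fst q) (snd q)) \<le> prob (\<Union>p\<in>pairs. excess_cover a (fst q) (snd q) p)"
      by (intro finite_measure_mono sums_exceed_subset a sets.finite_UN finite_pairs excess_cover_sets)
    also have "\<dots> \<le> (\<Sum>p\<in>pairs. prob (excess_cover a (fst q) (snd q) p))"
      by (intro measure_UNION_le finite_pairs excess_cover_sets)
    also have "\<dots> \<le> (\<Sum>p\<in>pairs. (1 + \<epsilon>) * pair_tail p (fst q) (snd q))"
      using elim by (intro sum_mono) auto
    finally show ?case by (simp add: tail_sum_def sum_distrib_left)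
  qed
qed

lemma sums_asymp_equiv: "(\<lambda>q. prob (sums_exceed (fst q) (snd q))) \<sim>[at_top \<times>\<^sub>F at_top] tail_sum"
proof (rule asymp_equiv_if_close[OF tail_sum_pos _ sums_upper])
  fix \<epsilon> :: real assume "\<epsilon> > 0"
  from max_lower[OF this]
  show "\<forall>\<^sub>F q in at_top \<times>\<^sub>F at_top. (1 - \<epsilon>) * tail_sum q \<le> prob (sums_exceed (fst q) (snd q))"
    by eventually_elim (rule order.trans[OF _ max_le_sums])
qed

text \<open>Almost surely the partial sums increase, so the last one is their maximum.\<close>
lemma max_of_sums_exceed:
  "\<P>(\<omega> in M. (MAX i\<in>{1..n}. \<Sum>k=1..i. Z k \<omega>) > x \<and> (MAX j\<in>{1..m}. \<Sum>l=1..j. W l \<omega>) > y) =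
    prob (sums_exceed x y)"
proof -
  have le: "(\<Sum>k=1..i. z k) \<le> (\<Sum>k=1..r. z k)" if "\<forall>k\<in>{1..r}. 0 \<le> z k" "i \<in> {1..r}"
    for z :: "nat \<Rightarrow> real" and i r
    using that by (intro sum_mono2) auto
  have max: "(MAX i\<in>{1..r}. \<Sum>k=1..i. z k) = (\<Sum>k=1..r. z k)" if "\<forall>k\<in>{1..r}. 0 \<le> z k" "r \<ge> 1"
    for z :: "nat \<Rightarrow> real" and r
  proof (rule Max_eqI)
    fix v assume "v \<in> (\<lambda>i. \<Sum>k=1..i. z k) ` {1..r}"
    then show "v \<le> (\<Sum>k=1..r. z k)" using le[OF that(1)] by blast
  qed (use that(2) in auto)
  have [measurable]: "(\<lambda>\<omega>. MAX i\<in>{1..n}. \<Sum>k=1..i. Z k \<omega>) \<in> borel_measurable M"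
    "(\<lambda>\<omega>. MAX i\<in>{1..m}. \<Sum>k=1..i. W k \<omega>) \<in> borel_measurable M"
    by (auto intro!: borel_measurable_Max borel_measurable_sum)
  show ?thesis unfolding sums_exceed_def
  proof (rule prob_eq_AE)
    show "AE \<omega> in M. (MAX i\<in>{1..n}. \<Sum>k=1..i. Z k \<omega>) > x \<and> (MAX j\<in>{1..m}. \<Sum>l=1..j. W l \<omega>) > y \<longleftrightarrow>
        (\<Sum>k=1..n. Z k \<omega>) > x \<and> (\<Sum>l=1..m. W l \<omega>) > y"
      using AE_nonneg by eventually_elim (use max n m in auto)
  qed measurable
qed

lemma max_exceed:
  "{\<omega> \<in> space M. (MAX k\<in>{1..n}. Z k \<omega>) > x \<and> (MAX l\<in>{1..m}. W l \<omega>) > y} = (\<Union>p\<in>pairs. both_exceed p x y)"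
proof -
  have "(MAX k\<in>{1..n}. Z k \<omega>) > x \<longleftrightarrow> (\<exists>k\<in>{1..n}. x < Z k \<omega>)"
    "(MAX l\<in>{1..m}. W l \<omega>) > y \<longleftrightarrow> (\<exists>l\<in>{1..m}. y < W l \<omega>)" for \<omega>
    using n m by (subst Max_gr_iff; auto)+
  then show ?thesis by (auto simp: pairs_def both_exceed_def)
qed

end

section \<open>Weighted sums\<close>

theorem theorem6p1:
  fixes M :: "'a measure" and n :: nat
    and X Y \<Theta> \<Delta> :: "nat \<Rightarrow> 'a \<Rightarrow> real"
    and F G :: "nat \<Rightarrow> real \<Rightarrow> real"
    and \<xi> \<delta> \<gamma> \<zeta> :: "nat \<Rightarrow> real"
  assumes "prob_space M" and "n \<ge> 1"
    and "\<And>k. k \<in> {1..n} \<Longrightarrow> X k \<in> borel_measurable M"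
    and "\<And>l. l \<in> {1..n} \<Longrightarrow> Y l \<in> borel_measurable M"
    and "\<And>k. k \<in> {1..n} \<Longrightarrow> \<Theta> k \<in> borel_measurable M"
    and "\<And>l. l \<in> {1..n} \<Longrightarrow> \<Delta> l \<in> borel_measurable M"
    and "\<And>k. k \<in> {1..n} \<Longrightarrow> AE \<omega> in M. X k \<omega> \<ge> 0"
    and "\<And>l. l \<in> {1..n} \<Longrightarrow> AE \<omega> in M. Y l \<omega> \<ge> 0"
    and "\<And>k. k \<in> {1..n} \<Longrightarrow> F k = cdf (distr M borel (X k))"
    and "\<And>l. l \<in> {1..n} \<Longrightarrow> G l = cdf (distr M borel (Y l))"
    and "\<And>k. k \<in> {1..n} \<Longrightarrow> F k \<in> class_D \<inter> class_L"
    and "\<And>l. l \<in> {1..n} \<Longrightarrow> G l \<in> class_D \<inter> class_L"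
    and "GTAI M n X n Y"
    and "\<And>k l. k \<in> {1..n} \<Longrightarrow> l \<in> {1..n} \<Longrightarrow> (X k, Y l) \<in> class_DL2 M"
    and "prob_space.indep_var M
           (PiM {1..n} (\<lambda>_. borel) \<Otimes>\<^sub>M PiM {1..n} (\<lambda>_. borel))
           (\<lambda>\<omega>. (\<lambda>k\<in>{1..n}. \<Theta> k \<omega>, \<lambda>l\<in>{1..n}. \<Delta> l \<omega>))
           (PiM {1..n} (\<lambda>_. borel) \<Otimes>\<^sub>M PiM {1..n} (\<lambda>_. borel))
           (\<lambda>\<omega>. (\<lambda>k\<in>{1..n}. X k \<omega>, \<lambda>l\<in>{1..n}. Y l \<omega>))"
    and "\<And>k. k \<in> {1..n} \<Longrightarrow> 0 < \<xi> k \<and> \<xi> k \<le> \<delta> k"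
    and "\<And>l. l \<in> {1..n} \<Longrightarrow> 0 < \<gamma> l \<and> \<gamma> l \<le> \<zeta> l"
    and "\<And>k. k \<in> {1..n} \<Longrightarrow> AE \<omega> in M. \<xi> k \<le> \<Theta> k \<omega> \<and> \<Theta> k \<omega> \<le> \<delta> k"
    and "\<And>l. l \<in> {1..n} \<Longrightarrow> AE \<omega> in M. \<gamma> l \<le> \<Delta> l \<omega> \<and> \<Delta> l \<omega> \<le> \<zeta> l"
  shows "GTAI M n (\<lambda>k \<omega>. \<Theta> k \<omega> * X k \<omega>) n (\<lambda>l \<omega>. \<Delta> l \<omega> * Y l \<omega>) \<and>
    (\<forall>k\<in>{1..n}. \<forall>l\<in>{1..n}. (\<lambda>\<omega>. \<Theta> k \<omega> * X k \<omega>, \<lambda>\<omega>. \<Delta> l \<omega> * Y l \<omega>) \<in> class_DL2 M) \<and>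
    (TAI M n X \<and> TAI M n Y \<longrightarrow>
      (\<lambda>(x, y). \<P>(\<omega> in M. weighted_sum \<Theta> X n \<omega> > x \<and> weighted_sum \<Delta> Y n \<omega> > y))
        \<sim>[at_top \<times>\<^sub>F at_top]
      (\<lambda>(x, y). \<P>(\<omega> in M. (MAX i\<in>{1..n}. weighted_sum \<Theta> X i \<omega>) > x \<and>
                          (MAX j\<in>{1..n}. weighted_sum \<Delta> Y j \<omega>) > y)) \<and>
      (\<lambda>(x, y). \<P>(\<omega> in M. (MAX i\<in>{1..n}. weighted_sum \<Theta> X i \<omega>) > x \<and>
                          (MAX j\<in>{1..n}. weighted_sum \<Delta> Y j \<omega>) > y))
        \<sim>[at_top \<times>\<^sub>F at_top]
      (\<lambda>(x, y). \<P>(\<omega> in M. (MAX k\<in>{1..n}. \<Theta> k \<omega> * X k \<omega>) > x \<and>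
                          (MAX l\<in>{1..n}. \<Delta> l \<omega> * Y l \<omega>) > y)) \<and>
      (\<lambda>(x, y). \<P>(\<omega> in M. (MAX k\<in>{1..n}. \<Theta> k \<omega> * X k \<omega>) > x \<and>
                          (MAX l\<in>{1..n}. \<Delta> l \<omega> * Y l \<omega>) > y))
        \<sim>[at_top \<times>\<^sub>F at_top]
      (\<lambda>(x, y). \<Sum>k=1..n. \<Sum>l=1..n. \<P>(\<omega> in M. \<Theta> k \<omega> * X k \<omega> > x \<and> \<Delta> l \<omega> * Y l \<omega> > y)))"
proof -
  interpret prob_space M by fact
  let ?Z = "\<lambda>k \<omega>. \<Theta> k \<omega> * X k \<omega>" and ?W = "\<lambda>l \<omega>. \<Delta> l \<omega> * Y l \<omega>"
  have X: "\<And>k. k \<in> {1..n} \<Longrightarrow> nonneg_rv (X k)" and Y: "\<And>l. l \<in> {1..n} \<Longrightarrow> nonneg_rv (Y l)"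
    using assms(3,4,7,8) by (auto simp: nonneg_rv_def)
  have \<Theta>: "\<And>k. k \<in> {1..n} \<Longrightarrow> weight_between (\<xi> k) (\<delta> k) (\<Theta> k)"
    and \<Delta>: "\<And>l. l \<in> {1..n} \<Longrightarrow> weight_between (\<gamma> l) (\<zeta> l) (\<Delta> l)"
    using assms(5,6,16-19) by (auto simp: weight_between_def)
  have indep: "indep_var (borel \<Otimes>\<^sub>M borel) (\<lambda>\<omega>. (\<Theta> k \<omega>, \<Delta> l \<omega>)) (borel \<Otimes>\<^sub>M borel) (\<lambda>\<omega>. (X k \<omega>, Y l \<omega>))"
    if kl: "k \<in> {1..n}" "l \<in> {1..n}" for k l
  proof -
    let ?N = "PiM {1..n} (\<lambda>_. borel) \<Otimes>\<^sub>M PiM {1..n} (\<lambda>_. borel) :: ((nat \<Rightarrow> real) \<times> (nat \<Rightarrow> real)) measure"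
    have proj: "(\<lambda>p. (fst p k, snd p l)) \<in> measurable ?N (borel \<Otimes>\<^sub>M borel)"
      using kl by (intro measurable_Pair measurable_compose[OF measurable_fst measurable_component_singleton]
          measurable_compose[OF measurable_snd measurable_component_singleton])
    from indep_var_compose[OF assms(15) proj proj] show ?thesis
      using kl by (simp add: comp_def)
  qed
  have D: "scaling_bounded (joint_tail M (X k) (Y l))" "scaling_bounded (joint_tail M (Y l) (X k))"
    if kl: "k \<in> {1..n}" "l \<in> {1..n}" for k l
  proof -
    show *: "scaling_bounded (joint_tail M (X k) (Y l))"
      using assms(14)[OF kl] class_D2_iff[OF assms(3)[OF kl(1)] assms(4)[OF kl(2)]]
      by (simp add: class_DL2_def)
    show "scaling_bounded (joint_tail M (Y l) (X k))"
      by (rule scaling_bounded_swap[OF *]) (rule joint_tail_swap)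
  qed
  have GTAI: "GTAI M n ?Z n ?W"
    unfolding GTAI_iff_GTAI_left
  proof
    have G: "GTAI_left M n X n Y" "GTAI_left M n Y n X"
      using assms(13) GTAI_iff_GTAI_left by auto
    show "GTAI_left M n ?Z n ?W"
      by (rule GTAI_left_weighted[where \<xi> = \<xi> and \<delta> = \<delta> and \<gamma> = \<gamma> and \<zeta> = \<zeta>])
        (blast intro: X \<Theta> Y \<Delta> D G)+
    show "GTAI_left M n ?W n ?Z"
      by (rule GTAI_left_weighted[where \<xi> = \<gamma> and \<delta> = \<zeta> and \<gamma> = \<xi> and \<zeta> = \<delta>])
        (blast intro: X \<Theta> Y \<Delta> D G)+
  qed
  have DL2: "(?Z k, ?W l) \<in> class_DL2 M" if "k \<in> {1..n}" "l \<in> {1..n}" for k l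
    by (rule weighted_in_class_DL2[OF X[OF that(1)] \<Theta>[OF that(1)] Y[OF that(2)] \<Delta>[OF that(2)]
          indep[OF that] assms(14)[OF that]])
  interpret asymptotically_independent_tails M n n ?Z ?W
  proof unfold_locales
    show "n \<ge> 1" by (fact assms(2))
    show "nonneg_rv (?Z k)" if "k \<in> {1..n}" for k
      by (rule nonneg_rv_weighted[OF X[OF that] \<Theta>[OF that]])
    show "nonneg_rv (?W l)" if "l \<in> {1..n}" for l
      by (rule nonneg_rv_weighted[OF Y[OF that] \<Delta>[OF that]])
  qed (fact DL2 GTAI)+
  have sums: "(\<lambda>(x, y). \<P>(\<omega> in M. weighted_sum \<Theta> X n \<omega> > x \<and> weighted_sum \<Delta> Y n \<omega> > y)) =
      (\<lambda>q. prob (sums_exceed (fst q) (snd q)))"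
    by (simp add: sums_exceed_def weighted_sum_def case_prod_unfold)
  have max_sums: "(\<lambda>(x, y). \<P>(\<omega> in M. (MAX i\<in>{1..n}. weighted_sum \<Theta> X i \<omega>) > x \<and>
      (MAX j\<in>{1..n}. weighted_sum \<Delta> Y j \<omega>) > y)) = (\<lambda>q. prob (sums_exceed (fst q) (snd q)))"
    unfolding weighted_sum_def max_of_sums_exceed by (simp add: case_prod_unfold)
  have maxes: "(\<lambda>(x, y). \<P>(\<omega> in M. (MAX k\<in>{1..n}. ?Z k \<omega>) > x \<and> (MAX l\<in>{1..n}. ?W l \<omega>) > y)) =
      (\<lambda>q. prob (\<Union>p\<in>pairs. both_exceed p (fst q) (snd q)))"
    unfolding max_exceed by (simp add: case_prod_unfold)
  have double_sum: "(\<lambda>(x, y). \<Sum>k=1..n. \<Sum>l=1..n. \<P>(\<omega> in M. ?Z k \<omega> > x \<and> ?W l \<omega> > y)) = tail_sum"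
    by (simp add: fun_eq_iff tail_sum_def pair_tail_def joint_tail_def pairs_def sum.cartesian_product case_prod_unfold)
  show ?thesis
    unfolding sums max_sums maxes double_sum
    by (intro conjI ballI impI GTAI DL2 asymp_equiv_refl max_asymp_equiv
        asymp_equiv_trans[OF sums_asymp_equiv asymp_equiv_symI[OF max_asymp_equiv]])
qed

end
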